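(* Fix $d\in\mathbb{N}$ and $n\ge d$. Let $P\subset\mathbb{R}^n$ be a polyhedral set with non-empty interior and let $A\in\mathbb{R}^{d\times n}$ be a Gaussian matrix, i.e. a random matrix whose entries are independent standard Gaussian random variables. Then $$\mathbb{E}\sum_{F\in\mathcal{F}_j(AP)}\gamma_k\big(T_F(AP)\big)=\sum_{G\in\mathcal{F}_j(P)}\Big(\gamma_k\big(T_G(P)\big)-\gamma_d\big(T_G(P)\big)\Big)$$ for all $j\in\{0,\dots,d-1\}$ and $k\in\{j-1,\dots,d-1\}$, where $\gamma_{-1}(C):=1$ for every cone $C$.
   Context: $\mathbb{N}=\{1,2,\dots\}$. A polyhedral set is an intersection of finitely many closed half-spaces (whose boundaries need not pass through the origin). $\mathcal{F}_j(P)$ is the set of $j$-dimensional faces of a polyhedral set $P$ ($P$ itself being a face). The tangent cone of a polyhedral set $P\subset\mathbb{R}^N$ at a face $F$ is $T_F(P)=\{v\in\mathbb{R}^N: f_0+\varepsilon v\in P\text{ for some }\varepsilon>0\}$, where $f_0$ is any point of the relative interior of $F$. For a polyhedral cone $C\subset\mathbb{R}^N$ and $k\in\{0,\dots,N\}$, the $k$-th Grassmann angle is $\gamma_k(C)=\mathbb{P}[W_{N-k}\cap C\neq\{0\}]$, where $W_{N-k}$ is a random $(N-k)$-dimensional linear subspace of $\mathbb{R}^N$ with the uniform (rotation invariant) distribution on the Grassmannian. This does not depend on the dimension $N$ of the ambient space. In the theorem, $T_F(AP)$ is a cone in $\mathbb{R}^d$ and $T_G(P)$ a cone in $\mathbb{R}^n$;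 the Grassmann angles of $T_F(AP)$ are computed for each realization of $A$. *)

theory Defs
  imports "HOL-Probability.Probability"
begin

definition faces_of_dim :: "nat \<Rightarrow> 'a::euclidean_space set \<Rightarrow> 'a set set" where
  "faces_of_dim j P = {F. F face_of P \<and> aff_dim F = int j}"

(* For polyhedral P the cone does not depend on the point picked in the relative interior. *)
definition tangent_cone :: "'a::euclidean_space set \<Rightarrow> 'a set \<Rightarrow> 'a set" where
  "tangent_cone F P =
     (let f0 = (SOME f. f \<in> rel_interior F) in {v. \<exists>\<epsilon>>0. f0 + \<epsilon> *\<^sub>R v \<in> P})"

definition Grassmannian :: "nat \<Rightarrow> 'a::euclidean_space set set" where
  "Grassmannian m = {W. subspace W \<and> dim W = m}"

(* On a subspace W, closest_point W is the orthogonal projection onto W. The topology of the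
   Grassmannian is the one it inherits from linear maps when W is identified with its
   orthogonal projection; in finite dimension this is the topology of pointwise convergence, so the
   Borel sigma-algebra is generated by the evaluations at the points x. *)
definition Grassmannian_borel :: "nat \<Rightarrow> 'a::euclidean_space set measure" where
  "Grassmannian_borel m =
     sigma (Grassmannian m)
       {{W \<in> Grassmannian m. closest_point W x \<in> B} | x B. B \<in> sets borel}"

(* Invariance under the full orthogonal group; for probability measures on the Grassmannian this
   is the same as invariance under its determinant-one subgroup, which already acts transitively. *)
definition rotation_invariant :: "'a::euclidean_space set measure \<Rightarrow> bool" where
  "rotation_invariant \<nu> \<longleftrightarrow>
     (\<forall>T. orthogonal_transformation T \<longrightarrow> distr \<nu> \<nu> (\<lambda>W. T ` W) = \<nu>)"

(* There is exactly one such measure for every m \<le> DIM('a), the only case used below. *)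
definition uniform_Grassmannian :: "nat \<Rightarrow> 'a::euclidean_space set measure" where
  "uniform_Grassmannian m =
     (THE \<nu>. prob_space \<nu> \<and> space \<nu> = Grassmannian m \<and>
            sets \<nu> = sets (Grassmannian_borel m) \<and> rotation_invariant \<nu>)"

(* The index is an integer because the value 1 is prescribed at k = -1. *)
definition Grassmann_angle :: "int \<Rightarrow> 'a::euclidean_space set \<Rightarrow> real" where
  "Grassmann_angle k C =
     (if k = -1 then 1
      else measure (uniform_Grassmannian (DIM('a) - nat k))
             {W \<in> Grassmannian (DIM('a) - nat k). W \<inter> C \<noteq> {0}})"

definition gaussian_matrix ::
  "'w measure \<Rightarrow> ('w \<Rightarrow> real ^ 'n::finite ^ 'd::finite) \<Rightarrow> bool" where
  "gaussian_matrix M A \<longleftrightarrow>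
     prob_space.indep_vars M (\<lambda>_. borel) (\<lambda>(i, j) \<omega>. A \<omega> $ i $ j) (UNIV :: ('d \<times> 'n) set) \<and>
     (\<forall>i j. distributed M lborel (\<lambda>\<omega>. A \<omega> $ i $ j) (\<lambda>x. ennreal (std_normal_density x)))"

end

theory Submission
  imports Defs
begin

text \<open>
  Fix a face \<open>G\<close> of \<open>P\<close> with tangent cone \<open>C\<close>. Its image under \<open>A\<close> is a face of \<open>A P\<close> of the same
  dimension if the kernel of \<open>A\<close> meets \<open>C\<close> only in 0, and then the tangent cone of \<open>A P\<close> at the
  image is \<open>A C\<close>. Almost surely all \<open>j\<close>-dimensional faces of \<open>A P\<close> arise in this way from exactly
  one \<open>j\<close>-dimensional face of \<open>P\<close>, because \<open>j < d\<close> and the kernel of a Gaussian matrix is in general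
  position with respect to the finitely many faces. So the expected sum over the faces of \<open>A P\<close> is the
  sum over the \<open>j\<close>-dimensional faces of \<open>P\<close> of the expectation of \<open>\<gamma>\<^sub>k (A C)\<close> on the event that
  \<open>ker A \<inter> C = {0}\<close>.

  To compute this expectation, write \<open>\<gamma>\<^sub>k (A C)\<close> as the probability that an independent uniform
  subspace \<open>W\<close> of codimension \<open>k\<close> meets \<open>A C\<close> nontrivially. If \<open>ker A \<inter> C = {0}\<close>, this happens exactly
  if the preimage of \<open>W\<close> under \<open>A\<close> meets \<open>C\<close> nontrivially. The preimage contains the kernel, so the event that
  the kernel meets \<open>C\<close> nontrivially is contained in the event that the preimage does. The preimage
  is a uniform subspace of codimension \<open>k\<close> and the kernel is one of codimension \<open>d\<close>. Hence the
  expectation is \<open>\<gamma>\<^sub>k C - \<gamma>\<^sub>d C\<close> (lemma \<open>integral_Grassmann_angle_image\<close>). For \<open>k = -1\<close> the angle is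
  the constant 1 and only the kernel matters.

  Three ingredients carry the argument. First, the uniform distribution has to be shown to exist
  and to be unique, and preimages under Gaussian matrices have to be shown to follow it
  (\<open>is_uniform_Grassmannian_unique\<close>, \<open>gaussian_preimage_subspace_uniform\<close>). Uniqueness needs an
  average over the orthogonal group; Gram-Schmidt orthonormalisation of a Gaussian matrix replaces
  Haar measure. Second, \<open>faces_linear_image_bij\<close> describes the faces of a linear image of a convex
  set for every linear map, without any general position. This is needed because the sum must be
  measurable for all matrices, not only up to a null set. Third, the events in question
  quantify over the uncountably many points of a cone; their measurability follows from
  \<open>sets_exists_zero_fsigma\<close>, since cones of feasible directions are countable unions of compact sets.
\<close>

section \<open>Gram-Schmidt orthonormalisation\<close>

text \<open>
  The residual is normalised by \<^const>\<open>sgn\<close>, which maps 0 to 0. Hence a vector that depends on its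
  predecessors contributes 0, and no case distinction enters the recursion: every entry is a
  Borel function of the input, and the number of nonzero entries is the rank.
\<close>

fun gram_schmidt :: "(nat \<Rightarrow> 'a::real_inner) \<Rightarrow> nat \<Rightarrow> 'a" where
  "gram_schmidt v i =
     sgn (v i - (\<Sum>l<i. (v i \<bullet> gram_schmidt v l) *\<^sub>R gram_schmidt v l))"

declare gram_schmidt.simps [simp del]

lemma gram_schmidt_norm:
  "gram_schmidt v i \<bullet> gram_schmidt v i = (if gram_schmidt v i = 0 then 0 else 1)"
  by (subst (1 2 3) gram_schmidt.simps) (simp add: dot_square_norm norm_sgn sgn_zero_iff)

lemma gram_schmidt_orthogonal:
  assumes "i \<noteq> l"
  shows "gram_schmidt v i \<bullet> gram_schmidt v l = 0"
proof -
  let ?g = "gram_schmidt v"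
  have "\<forall>m<n. ?g n \<bullet> ?g m = 0" for n
  proof (induction n rule: less_induct)
    case (less n)
    have "(v n - (\<Sum>l<n. (v n \<bullet> ?g l) *\<^sub>R ?g l)) \<bullet> ?g m = 0" if "m < n" for m
    proof -
      have "?g l \<bullet> ?g m = 0" if "l < n" "l \<noteq> m" for l
        using less[of l] less[of m] that \<open>m < n\<close> by (metis inner_commute linorder_neqE_nat)
      then have "(\<Sum>l<n. (v n \<bullet> ?g l) *\<^sub>R ?g l) \<bullet> ?g m
          = (\<Sum>l<n. if l = m then (v n \<bullet> ?g m) * (?g m \<bullet> ?g m) else 0)"
        unfolding inner_sum_left by (intro sum.cong refl) auto
      also have "\<dots> = v n \<bullet> ?g m"
        using that by (simp add: gram_schmidt_norm)
      finally show ?thesis by (simp add: inner_diff_left)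
    qed
    then show ?case
      by (subst gram_schmidt.simps[of v n]) (simp add: sgn_div_norm)
  qed
  then show ?thesis
    using assms by (metis inner_commute linorder_neqE_nat)
qed

lemma span_gram_schmidt: "span (gram_schmidt v ` {..<k}) = span (v ` {..<k})"
proof (induction k)
  case (Suc k)
  let ?g = "gram_schmidt v"
  let ?p = "\<Sum>l<k. (v k \<bullet> ?g l) *\<^sub>R ?g l"
  have p: "?p \<in> span (?g ` {..<k})"
    by (intro span_sum span_mul span_base) auto
  have gk: "?g k = sgn (v k - ?p)" by (rule gram_schmidt.simps)
  have "span (insert (?g k) (?g ` {..<k})) = span (insert (v k) (?g ` {..<k}))"
  proof -
    have "v k = norm (v k - ?p) *\<^sub>R ?g k + ?p"
      by (cases "v k - ?p = 0") (auto simp: gk sgn_div_norm)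
    moreover have "norm (v k - ?p) *\<^sub>R ?g k + ?p \<in> span (insert (?g k) (?g ` {..<k}))"
      using p span_mono[OF subset_insertI] by (blast intro: span_add span_mul span_base)
    ultimately have 1: "v k \<in> span (insert (?g k) (?g ` {..<k}))" by simp
    have 2: "?g k \<in> span (insert (v k) (?g ` {..<k}))"
      unfolding gk sgn_div_norm
      using p span_mono[OF subset_insertI] by (blast intro: span_diff span_mul span_base)
    show ?thesis
      unfolding span_eq using 1 2 by (auto intro: span_base)
  qed
  also have "\<dots> = span (insert (v k) (v ` {..<k}))"
    using Suc.IH by (metis span_insert)
  finally show ?case by (simp add: lessThan_Suc)
qed simp

text \<open>
  This turns rank conditions into finitely many conditions \<open>gram_schmidt v i \<noteq> 0\<close>, which
  are visibly measurable in the vectors.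
\<close>

lemma dim_span_gram_schmidt:
  fixes v :: "nat \<Rightarrow> 'a::euclidean_space"
  shows "dim (v ` {..<k}) = card {i\<in>{..<k}. gram_schmidt v i \<noteq> 0}"
proof -
  let ?g = "gram_schmidt v" and ?I = "{i\<in>{..<k}. gram_schmidt v i \<noteq> 0}"
  have inj: "inj_on ?g ?I"
    by (rule inj_onI) (metis (mono_tags, lifting) gram_schmidt_orthogonal inner_eq_zero_iff mem_Collect_eq)
  have "pairwise orthogonal (?g ` ?I)"
    by (auto simp: pairwise_def orthogonal_def dest: gram_schmidt_orthogonal)
       (metis gram_schmidt_orthogonal)
  then have "independent (?g ` ?I)"
    by (rule pairwise_orthogonal_independent) auto
  then have "dim (?g ` ?I) = card ?I"
    using card_image[OF inj] by (simp add: dim_eq_card_independent)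
  moreover have "span (?g ` ?I) = span (v ` {..<k})"
  proof -
    have "?g ` {..<k} - {0} = ?g ` ?I" by auto
    then show ?thesis by (metis span_delete_0 span_gram_schmidt)
  qed
  ultimately show ?thesis
    using dim_span[of "?g ` ?I"] dim_span[of "v ` {..<k}"] by simp
qed

lemma gram_schmidt_nonzero:
  fixes v :: "nat \<Rightarrow> 'a::euclidean_space"
  assumes "dim (v ` {..<k}) = k" "i < k"
  shows "gram_schmidt v i \<noteq> 0"
proof
  assume "gram_schmidt v i = 0"
  then have "{i\<in>{..<k}. gram_schmidt v i \<noteq> 0} \<subset> {..<k}" using assms(2) by auto
  then have "card {i\<in>{..<k}. gram_schmidt v i \<noteq> 0} < card {..<k}"
    by (intro psubset_card_mono) auto
  then show False using assms(1) dim_span_gram_schmidt[of v k] by simp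
qed

text \<open>
  The recursion uses only inner products and linear combinations, and both commute with
  orthogonal maps. This is what makes an orthonormalised Gaussian frame rotation invariant.
\<close>

lemma gram_schmidt_equivariant:
  fixes T :: "'a::euclidean_space \<Rightarrow> 'a"
  assumes "orthogonal_transformation T"
  shows "gram_schmidt (\<lambda>i. T (v i)) i = T (gram_schmidt v i)"
proof (induction i rule: less_induct)
  case (less i)
  have lin: "linear T" using assms by (rule orthogonal_transformation_linear)
  have "gram_schmidt (\<lambda>i. T (v i)) i
      = sgn (T (v i) - (\<Sum>l<i. (T (v i) \<bullet> T (gram_schmidt v l)) *\<^sub>R T (gram_schmidt v l)))"
    by (subst gram_schmidt.simps) (simp add: less)
  also have "\<dots> = sgn (T (v i - (\<Sum>l<i. (v i \<bullet> gram_schmidt v l) *\<^sub>R gram_schmidt v l)))"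
    using assms by (simp add: linear_diff[OF lin] linear_sum[OF lin] linear_scale[OF lin]
        orthogonal_transformation_def)
  also have "\<dots> = T (gram_schmidt v i)"
    by (subst (2) gram_schmidt.simps)
       (simp add: sgn_div_norm linear_scale[OF lin] orthogonal_transformation_norm[OF assms])
  finally show ?case .
qed

lemma borel_measurable_gram_schmidt [measurable]:
  fixes v :: "'s \<Rightarrow> nat \<Rightarrow> 'a::euclidean_space"
  assumes [measurable]: "\<And>i. (\<lambda>s. v s i) \<in> borel_measurable S"
  shows "(\<lambda>s. gram_schmidt (v s) i) \<in> borel_measurable S"
proof (induction i rule: less_induct)
  case (less i)
  have [measurable]: "(\<lambda>s. \<Sum>l<i. (v s i \<bullet> gram_schmidt (v s) l) *\<^sub>R gram_schmidt (v s) l)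
      \<in> borel_measurable S"
    by (intro borel_measurable_sum borel_measurable_scaleR borel_measurable_inner assms less) auto
  show ?case
    by (subst gram_schmidt.simps, unfold sgn_div_norm) measurable
qed

section \<open>Orthogonal projections\<close>

lemma closest_point_subspace_eqI:
  fixes W :: "'a::euclidean_space set"
  assumes "subspace W" "p \<in> W" "\<And>w. w \<in> W \<Longrightarrow> (x - p) \<bullet> w = 0"
  shows "closest_point W x = p"
proof -
  have "dist x p \<le> dist x w" if "w \<in> W" for w
  proof -
    have pw: "(x - p) \<bullet> (p - w) = 0" using assms that by (simp add: subspace_diff)
    have "norm (x - w) ^ 2 = norm (x - p) ^ 2 + norm (p - w) ^ 2"
      using pw by (simp add: power2_norm_eq_inner inner_diff_left inner_diff_right inner_commute)
    then have "norm (x - p) ^ 2 \<le> norm (x - w) ^ 2" by simp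
    then show ?thesis by (simp add: dist_norm power2_le_iff_abs_le)
  qed
  then show ?thesis
    using closest_point_unique[of W p x] assms
    by (simp add: subspace_imp_convex closed_subspace)
qed

lemma closest_point_subspace:
  fixes W :: "'a::euclidean_space set"
  assumes "subspace W"
  shows "closest_point W x \<in> W" "w \<in> W \<Longrightarrow> (x - closest_point W x) \<bullet> w = 0"
proof -
  obtain y z where "y \<in> W" "\<And>w. w \<in> W \<Longrightarrow> orthogonal z w" "x = y + z"
    using orthogonal_subspace_decomp_exists[of W x] assms by (metis span_eq_iff)
  moreover from this have "closest_point W x = y"
    by (intro closest_point_subspace_eqI assms) (auto simp: orthogonal_def)
  ultimately show "closest_point W x \<in> W" "w \<in> W \<Longrightarrow> (x - closest_point W x) \<bullet> w = 0"
    by (auto simp: orthogonal_def)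
qed

lemma linear_closest_point_subspace:
  fixes W :: "'a::euclidean_space set"
  assumes "subspace W"
  shows "linear (closest_point W)"
proof (rule linearI)
  note cp = closest_point_subspace[OF assms]
  fix x y :: 'a and c :: real
  show "closest_point W (x + y) = closest_point W x + closest_point W y"
  proof (rule closest_point_subspace_eqI[OF assms])
    show "closest_point W x + closest_point W y \<in> W"
      by (intro subspace_add assms cp)
    show "(x + y - (closest_point W x + closest_point W y)) \<bullet> w = 0" if "w \<in> W" for w
      using cp(2)[OF that, of x] cp(2)[OF that, of y] by (simp add: inner_diff_left inner_add_left)
  qed
  show "closest_point W (c *\<^sub>R x) = c *\<^sub>R closest_point W x"
  proof (rule closest_point_subspace_eqI[OF assms])
    show "c *\<^sub>R closest_point W x \<in> W"
      by (intro subspace_scale assms cp)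
    show "(c *\<^sub>R x - c *\<^sub>R closest_point W x) \<bullet> w = 0" if "w \<in> W" for w
      using cp(2)[OF that, of x] by (simp add: inner_diff_left)
  qed
qed

lemma closest_point_subspace_refl:
  fixes W :: "'a::euclidean_space set"
  assumes "subspace W"
  shows "closest_point W x = x \<longleftrightarrow> x \<in> W"
  using closest_point_refl[of W x] assms closed_subspace subspace_0 by blast

lemma closest_point_orthogonal_image:
  fixes T :: "'a::euclidean_space \<Rightarrow> 'a"
  assumes T: "orthogonal_transformation T" and W: "subspace W"
  shows "closest_point (T ` W) (T x) = T (closest_point W x)"
proof (rule closest_point_subspace_eqI)
  have lin: "linear T" using T by (rule orthogonal_transformation_linear)
  show "subspace (T ` W)" by (rule linear_subspace_image[OF lin W])
  show "T (closest_point W x) \<in> T ` W" using closest_point_subspace(1)[OF W] by blast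
  fix w assume "w \<in> T ` W"
  then obtain u where "u \<in> W" "w = T u" by auto
  then show "(T x - T (closest_point W x)) \<bullet> w = 0"
    using closest_point_subspace(2)[OF W] T
    by (simp add: linear_diff[OF lin, symmetric] orthogonal_transformation_def)
qed

text \<open>
  Subtracting the components along an orthonormal basis of the span of the \<open>v i\<close> leaves the
  orthogonal complement; the zero entries of the Gram-Schmidt sequence do no harm. The explicit
  right-hand side shows that the projection depends measurably on the vectors.
\<close>

lemma closest_point_orthogonal_complement:
  fixes v :: "nat \<Rightarrow> 'a::euclidean_space"
  shows "closest_point {x. \<forall>i<k. v i \<bullet> x = 0} y
    = y - (\<Sum>i<k. (y \<bullet> gram_schmidt v i) *\<^sub>R gram_schmidt v i)" (is "closest_point ?W y = ?p")
proof -
  let ?g = "gram_schmidt v"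
  have W: "?W = {x. \<forall>i<k. ?g i \<bullet> x = 0}"
  proof -
    have orth: "(\<forall>i<k. f i \<bullet> x = 0) \<longleftrightarrow> (\<forall>u\<in>span (f ` {..<k}). orthogonal x u)"
      for x and f :: "nat \<Rightarrow> 'a"
    proof
      assume "\<forall>i<k. f i \<bullet> x = 0"
      then have "orthogonal x u" if "u \<in> f ` {..<k}" for u
        using that by (auto simp: orthogonal_def inner_commute)
      then show "\<forall>u\<in>span (f ` {..<k}). orthogonal x u"
        by (meson orthogonal_to_span)
    qed (auto simp: orthogonal_def inner_commute span_base)
    show ?thesis
      unfolding orth span_gram_schmidt ..
  qed
  have "?g i \<bullet> (\<Sum>l<k. (y \<bullet> ?g l) *\<^sub>R ?g l) = ?g i \<bullet> y" if "i < k" for i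
  proof -
    have "?g i \<bullet> (\<Sum>l<k. (y \<bullet> ?g l) *\<^sub>R ?g l)
        = (\<Sum>l<k. if l = i then (y \<bullet> ?g i) * (?g i \<bullet> ?g i) else 0)"
      unfolding inner_sum_right by (intro sum.cong refl) (auto simp: gram_schmidt_orthogonal inner_commute)
    then show ?thesis using that by (simp add: gram_schmidt_norm inner_commute)
  qed
  then have "?p \<in> ?W" unfolding W by (simp add: inner_diff_right)
  moreover have "subspace ?W"
    by (auto simp: subspace_def inner_add_right)
  moreover have "(y - ?p) \<bullet> w = 0" if "w \<in> ?W" for w
    using that unfolding W by (simp add: inner_sum_left)
  ultimately show ?thesis by (intro closest_point_subspace_eqI) auto
qed

section \<open>The Grassmannian as a measurable space\<close>

lemma space_Grassmannian_borel [simp]: "space (Grassmannian_borel m) = Grassmannian m"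
  unfolding Grassmannian_borel_def by (rule space_measure_of) auto

lemma measurable_closest_point [measurable]:
  "(\<lambda>W. closest_point W x) \<in> borel_measurable (Grassmannian_borel m)"
proof (rule measurableI)
  fix B :: "'a set" assume "B \<in> sets borel"
  then have "{W \<in> Grassmannian m. closest_point W x \<in> B} \<in> sets (Grassmannian_borel m)"
    unfolding Grassmannian_borel_def by (intro in_measure_of) auto
  moreover have "(\<lambda>W. closest_point W x) -` B \<inter> space (Grassmannian_borel m)
      = {W \<in> Grassmannian m. closest_point W x \<in> B}" by auto
  ultimately show "(\<lambda>W. closest_point W x) -` B \<inter> space (Grassmannian_borel m)
      \<in> sets (Grassmannian_borel m)" by simp
qed simp

lemma measurable_Grassmannian_borelI:
  assumes "\<And>s. s \<in> space S \<Longrightarrow> f s \<in> Grassmannian m"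
    and "\<And>x. (\<lambda>s. closest_point (f s) x) \<in> borel_measurable S"
  shows "f \<in> S \<rightarrow>\<^sub>M Grassmannian_borel m"
  unfolding Grassmannian_borel_def
proof (rule measurable_measure_of)
  fix y :: "'b set set"
  assume "y \<in> {{W \<in> Grassmannian m. closest_point W x \<in> B} |x B. B \<in> sets borel}"
  then obtain x and B :: "'b set" where B: "B \<in> sets borel"
    and y: "y = {W \<in> Grassmannian m. closest_point W x \<in> B}" by auto
  have "f -` y \<inter> space S = (\<lambda>s. closest_point (f s) x) -` B \<inter> space S"
    using assms(1) y by auto
  then show "f -` y \<inter> space S \<in> sets S"
    using measurable_sets[OF assms(2) B] by simp
qed (use assms(1) in auto)

text \<open>
  The generators of the \<open>\<sigma>\<close>-algebra evaluate the projection at a fixed point. By linearity of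
  the projection, finitely many fixed points, those of a basis, control it at a moving point.
\<close>

lemma measurable_closest_point2:
  fixes V :: "'s \<Rightarrow> 'a::euclidean_space set"
  assumes V: "V \<in> S \<rightarrow>\<^sub>M Grassmannian_borel m" and [measurable]: "y \<in> borel_measurable S"
  shows "(\<lambda>s. closest_point (V s) (y s)) \<in> borel_measurable S"
proof -
  have [measurable]: "(\<lambda>s. closest_point (V s) b) \<in> borel_measurable S" for b
    by (rule measurable_compose[OF V measurable_closest_point])
  have "closest_point (V s) (y s) = (\<Sum>b\<in>Basis. (y s \<bullet> b) *\<^sub>R closest_point (V s) b)"
    if "s \<in> space S" for s
  proof -
    have "subspace (V s)"
      using measurable_space[OF V that] by (simp add: Grassmannian_def)
    then have lin: "linear (closest_point (V s))"
      by (rule linear_closest_point_subspace)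
    have "closest_point (V s) (y s) = closest_point (V s) (\<Sum>b\<in>Basis. (y s \<bullet> b) *\<^sub>R b)"
      by (simp add: euclidean_representation)
    also have "\<dots> = (\<Sum>b\<in>Basis. (y s \<bullet> b) *\<^sub>R closest_point (V s) b)"
      by (simp add: linear_sum[OF lin] linear_scale[OF lin])
    finally show ?thesis .
  qed
  then show ?thesis
    by (subst measurable_cong[where g = "\<lambda>s. \<Sum>b\<in>Basis. (y s \<bullet> b) *\<^sub>R closest_point (V s) b"]) auto
qed

lemma orthogonal_transformation_image_Grassmannian:
  fixes T :: "'a::euclidean_space \<Rightarrow> 'a"
  assumes "orthogonal_transformation T" "W \<in> Grassmannian m"
  shows "T ` W \<in> Grassmannian m"
  using assms dim_image_eq[of T W] orthogonal_transformation_inj[OF assms(1)]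
  by (auto simp: Grassmannian_def orthogonal_transformation_linear linear_subspace_image
      intro: inj_on_subset)

text \<open>
  The projection onto \<open>T ` V\<close> is the projection onto \<open>V\<close> conjugated by \<open>T\<close>, so both \<open>T\<close> and
  its inverse have to depend measurably on the parameter.
\<close>

lemma measurable_orthogonal_image:
  fixes T :: "'s \<Rightarrow> 'a::euclidean_space \<Rightarrow> 'a"
  assumes T: "\<And>s. s \<in> space S \<Longrightarrow> orthogonal_transformation (T s)"
    and meas: "\<And>x. (\<lambda>s. T s x) \<in> borel_measurable S" 
    and inv: "\<And>x. (\<lambda>s. inv (T s) x) \<in> borel_measurable S"
    and V: "V \<in> S \<rightarrow>\<^sub>M Grassmannian_borel m"
  shows "(\<lambda>s. T s ` V s) \<in> S \<rightarrow>\<^sub>M Grassmannian_borel m"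
proof (rule measurable_Grassmannian_borelI)
  show "T s ` V s \<in> Grassmannian m" if "s \<in> space S" for s
    using measurable_space[OF V that] T[OF that] by (simp add: orthogonal_transformation_image_Grassmannian)
  fix x
  define p where "p s = closest_point (V s) (inv (T s) x)" for s
  have [measurable]: "p \<in> borel_measurable S"
    unfolding p_def by (intro measurable_closest_point2[OF V] inv)
  have "closest_point (T s ` V s) x = (\<Sum>b\<in>Basis. (p s \<bullet> b) *\<^sub>R T s b)"
    if s: "s \<in> space S" for s
  proof -
    have V': "subspace (V s)"
      using measurable_space[OF V s] by (simp add: Grassmannian_def)
    have lin: "linear (T s)" using T[OF s] by (rule orthogonal_transformation_linear)
    have "T s (inv (T s) x) = x"
      using orthogonal_transformation_surj[OF T[OF s]] by (rule surj_f_inv_f)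
    then have "closest_point (T s ` V s) x = T s (p s)"
      unfolding p_def by (metis closest_point_orthogonal_image[OF T[OF s] V'])
    also have "\<dots> = T s (\<Sum>b\<in>Basis. (p s \<bullet> b) *\<^sub>R b)"
      by (simp add: euclidean_representation)
    also have "\<dots> = (\<Sum>b\<in>Basis. (p s \<bullet> b) *\<^sub>R T s b)"
      by (simp add: linear_sum[OF lin] linear_scale[OF lin])
    finally show ?thesis .
  qed
  then show "(\<lambda>s. closest_point (T s ` V s) x) \<in> borel_measurable S"
    using meas
    by (subst measurable_cong[where g = "\<lambda>s. \<Sum>b\<in>Basis. (p s \<bullet> b) *\<^sub>R T s b"]) auto
qed

section \<open>Measurability of the existence of zeros\<close>

text \<open>
  An existential quantifier over an uncountable set does not preserve measurability in general.
  On a compact set a continuous function has a zero exactly if it takes arbitrarily small values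
  on a countable dense subset, and this only involves countable operations.
\<close>

lemma sets_exists_zero_compact:
  fixes K :: "'a::euclidean_space set" and h :: "'s \<Rightarrow> 'a \<Rightarrow> 'b::euclidean_space"
  assumes K: "compact K"
    and meas: "\<And>x. x \<in> K \<Longrightarrow> (\<lambda>s. h s x) \<in> borel_measurable S"
    and cont: "\<And>s. s \<in> space S \<Longrightarrow> continuous_on K (h s)"
  shows "{s\<in>space S. \<exists>x\<in>K. h s x = 0} \<in> sets S"
proof -
  obtain D where D: "countable D" "D \<subseteq> K" "K \<subseteq> closure D"
    using separable[of K] by metis
  have "(\<exists>x\<in>K. h s x = 0) \<longleftrightarrow> (\<forall>n. \<exists>x\<in>D. norm (h s x) < inverse (real (Suc n)))"
    if s: "s \<in> space S" for s
  proof
    assume "\<exists>x\<in>K. h s x = 0"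
    then obtain x where x: "x \<in> K" "h s x = 0" by auto
    show "\<forall>n. \<exists>x\<in>D. norm (h s x) < inverse (real (Suc n))"
    proof
      fix n
      have "\<exists>\<delta>>0. \<forall>y\<in>K. dist y x < \<delta> \<longrightarrow> dist (h s y) (h s x) < inverse (real (Suc n))"
        using cont[OF s] x(1) unfolding continuous_on_iff by (metis inverse_positive_iff_positive of_nat_0_less_iff zero_less_Suc)
      then obtain \<delta> where "\<delta> > 0"
        and \<delta>: "\<And>y. y \<in> K \<Longrightarrow> dist y x < \<delta> \<Longrightarrow> dist (h s y) (h s x) < inverse (real (Suc n))"
        by blast
      moreover obtain y where "y \<in> D" "dist y x < \<delta>"
        using D(3) x(1) \<open>\<delta> > 0\<close> by (meson closure_approachable subsetD)
      ultimately show "\<exists>x\<in>D. norm (h s x) < inverse (real (Suc n))"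
        using D(2) x(2) by (metis dist_0_norm dist_commute subsetD)
    qed
  next
    assume small: "\<forall>n. \<exists>x\<in>D. norm (h s x) < inverse (real (Suc n))"
    then have "K \<noteq> {}" using D(2) by auto
    then obtain x where x: "x \<in> K" "\<And>y. y \<in> K \<Longrightarrow> norm (h s x) \<le> norm (h s y)"
      using continuous_attains_inf[OF K, of "\<lambda>y. norm (h s y)"] cont[OF s]
      by (auto intro: continuous_on_norm)
    have "norm (h s x) < inverse (real (Suc n))" for n
      using small x(2) D(2) by (meson le_less_trans subsetD)
    then have "norm (h s x) \<le> 0"
      by (metis reals_Archimedean not_le less_asym)
    then show "\<exists>x\<in>K. h s x = 0" using x(1) by auto
  qed
  then have "{s\<in>space S. \<exists>x\<in>K. h s x = 0}
      = (\<Inter>n. \<Union>x\<in>D. {s\<in>space S. norm (h s x) < inverse (real (Suc n))})" by auto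
  moreover have "{s\<in>space S. norm (h s x) < inverse (real (Suc n))} \<in> sets S" if "x \<in> D" for n x
  proof -
    have [measurable]: "(\<lambda>s. h s x) \<in> borel_measurable S" using meas D(2) that by auto
    show ?thesis by measurable
  qed
  ultimately show ?thesis
    using D(1) by (auto intro!: sets.countable_INT sets.countable_UN')
qed

text \<open>
  Most of the sets over which zeros are sought below are cones with a subspace removed. They are
  in general neither compact nor closed, but they are countable unions of compact sets.
\<close>

lemma sets_exists_zero_fsigma:
  fixes K :: "'a::euclidean_space set" and h :: "'s \<Rightarrow> 'a \<Rightarrow> 'b::euclidean_space"
  assumes K: "fsigma_in euclidean K"
    and meas: "\<And>x. x \<in> K \<Longrightarrow> (\<lambda>s. h s x) \<in> borel_measurable S"
    and cont: "\<And>s. s \<in> space S \<Longrightarrow> continuous_on K (h s)"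
  shows "{s\<in>space S. \<exists>x\<in>K. h s x = 0} \<in> sets S"
proof -
  obtain C :: "nat \<Rightarrow> 'a set" where C: "\<And>n. closed (C n)" "(\<Union>n. C n) = K"
    using K by (auto simp: fsigma_in_ascending)
  define D where "D n m = C n \<inter> cball 0 (real m)" for n m
  have D: "compact (D n m)" "D n m \<subseteq> K" for n m
    using C by (auto simp: D_def closed_Int_compact)
  have K': "K = (\<Union>n. \<Union>m. D n m)"
    using C(2) real_arch_simple by (fastforce simp: D_def)
  have "{s\<in>space S. \<exists>x\<in>K. h s x = 0} = (\<Union>n. \<Union>m. {s\<in>space S. \<exists>x\<in>D n m. h s x = 0})"
    unfolding K' by auto
  moreover have "{s\<in>space S. \<exists>x\<in>D n m. h s x = 0} \<in> sets S" for n m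
    by (rule sets_exists_zero_compact[OF D(1)])
       (use D(2) meas cont continuous_on_subset in blast)+
  ultimately show ?thesis by auto
qed

lemma fsigma_in_closed_diff:
  fixes S T :: "'a::euclidean_space set"
  assumes "fsigma_in euclidean S" "closed T"
  shows "fsigma_in euclidean (S - T)"
  using assms by (intro fsigma_in_diff closed_imp_gdelta_in) (auto simp: metrizable_space_euclidean)

section \<open>Rotation invariance of Lebesgue and Gaussian measure\<close>

lemma nn_integral_lborel_translation:
  fixes c :: "'a::euclidean_space"
  assumes [measurable]: "f \<in> borel_measurable borel"
  shows "(\<integral>\<^sup>+x. f (c + x) \<partial>lborel) = (\<integral>\<^sup>+x. f x \<partial>lborel)"
proof -
  have "(\<integral>\<^sup>+x. f x \<partial>lborel) = (\<integral>\<^sup>+x. f x \<partial>distr lborel borel ((+) c))"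
    by (simp add: lborel_distr_plus)
  then show ?thesis by (simp add: nn_integral_distr)
qed

lemma borel_measurable_linear:
  fixes f :: "'a::euclidean_space \<Rightarrow> 'b::euclidean_space"
  assumes "linear f"
  shows "f \<in> borel_measurable borel"
  by (rule borel_measurable_continuous_onI, rule linear_continuous_on)
     (simp add: assms linear_conv_bounded_linear[symmetric])

text \<open>
  The image measure is invariant under translations, and a translation invariant Borel measure is
  determined by its value on the unit ball. The proof runs this argument for the two measures at
  hand: the integral of \<open>indicator B y * indicator X (T z + y)\<close> over both variables is computed in
  both orders. As \<open>T\<close> maps the unit ball onto itself, the two measures have the same mass there.
\<close>

lemma lborel_distr_orthogonal_transformation:
  fixes T :: "'a::euclidean_space \<Rightarrow> 'a"
  assumes T: "orthogonal_transformation T"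
  shows "distr lborel borel T = lborel"
proof (rule measure_eqI)
  have [measurable]: "T \<in> borel_measurable borel"
    by (rule borel_measurable_linear[OF orthogonal_transformation_linear[OF T]])
  have lin: "linear T" using T by (rule orthogonal_transformation_linear)
  fix X :: "'a set" assume "X \<in> sets (distr lborel borel T)"
  then have [measurable]: "X \<in> sets borel" by simp
  let ?B = "ball 0 1 :: 'a set"
  have [measurable]: "?B \<in> sets borel" by simp
  have B: "emeasure lborel ?B \<noteq> 0" "emeasure lborel ?B \<noteq> \<infinity>"
    using emeasure_lborel_ball_finite[of "0::'a" 1] content_ball_pos[of 1 "0::'a"]
    by (auto simp: measure_def)
  have "emeasure lborel (T -` X) * emeasure lborel ?B
      = (\<integral>\<^sup>+y. indicator ?B y * emeasure lborel (T -` X) \<partial>lborel)"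
    by (subst nn_integral_multc) (simp_all add: mult.commute borel_measurable_indicator)
  also have "\<dots> = (\<integral>\<^sup>+y. \<integral>\<^sup>+z. indicator ?B y * indicator X (T z + y) \<partial>lborel \<partial>lborel)"
  proof (rule nn_integral_cong)
    fix y :: 'a
    obtain c where c: "T c = y"
      using orthogonal_transformation_surj[OF T] by (metis surjD)
    have "(\<integral>\<^sup>+z. indicator X (T z + y) \<partial>lborel) = (\<integral>\<^sup>+z. indicator X (T (c + z)) \<partial>lborel :: ennreal)"
      by (simp add: c[symmetric] linear_add[OF lin] add.commute)
    also have "\<dots> = (\<integral>\<^sup>+z. indicator X (T z) \<partial>lborel)"
      by (rule nn_integral_lborel_translation[of "\<lambda>z. indicator X (T z)"]) measurable
    also have "\<dots> = (\<integral>\<^sup>+z. indicator (T -` X) z \<partial>lborel)"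
      by (simp add: indicator_vimage)
    also have "\<dots> = emeasure lborel (T -` X)"
      using measurable_sets[of T borel borel X] by (intro nn_integral_indicator) simp
    finally show "indicator ?B y * emeasure lborel (T -` X)
        = (\<integral>\<^sup>+z. indicator ?B y * indicator X (T z + y) \<partial>lborel)"
      by (simp add: nn_integral_cmult)
  qed
  also have "\<dots> = (\<integral>\<^sup>+z. \<integral>\<^sup>+y. indicator ?B y * indicator X (T z + y) \<partial>lborel \<partial>lborel)"
    by (rule lborel_pair.Fubini') measurable
  also have "\<dots> = (\<integral>\<^sup>+z. \<integral>\<^sup>+y. indicator ?B (y - T z) * indicator X y \<partial>lborel \<partial>lborel)"
  proof (rule nn_integral_cong)
    fix z :: 'a
    show "(\<integral>\<^sup>+y. indicator ?B y * indicator X (T z + y) \<partial>lborel)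
        = (\<integral>\<^sup>+y. indicator ?B (y - T z) * indicator X y \<partial>lborel)"
      using nn_integral_lborel_translation[of "\<lambda>y. indicator ?B (y - T z) * indicator X y" "T z"] by simp
  qed
  also have "\<dots> = (\<integral>\<^sup>+y. \<integral>\<^sup>+z. indicator ?B (y - T z) * indicator X y \<partial>lborel \<partial>lborel)"
    by (rule lborel_pair.Fubini'[symmetric]) measurable
  also have "\<dots> = (\<integral>\<^sup>+y. emeasure lborel ?B * indicator X y \<partial>lborel)"
  proof (rule nn_integral_cong)
    fix y :: 'a
    obtain c where c: "T c = y"
      using orthogonal_transformation_surj[OF T] by (metis surjD)
    have "indicator ?B (y - T z) = (indicator ?B (- c + z) :: ennreal)" for z
    proof -
      have "norm (y - T z) = norm (- c + z)"
        using orthogonal_transformation_norm[OF T, of "c - z"]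
        by (simp add: c linear_diff[OF lin] norm_minus_commute)
      then show ?thesis by (simp add: indicator_def)
    qed
    then have "(\<integral>\<^sup>+z. indicator ?B (y - T z) \<partial>lborel) = (\<integral>\<^sup>+z. indicator ?B z \<partial>lborel :: ennreal)"
      using nn_integral_lborel_translation[of "indicator ?B" "- c"] by simp
    then show "(\<integral>\<^sup>+z. indicator ?B (y - T z) * indicator X y \<partial>lborel) = emeasure lborel ?B * indicator X y"
      by (simp add: nn_integral_multc)
  qed
  also have "\<dots> = emeasure lborel X * emeasure lborel ?B"
    by (subst nn_integral_cmult) (simp_all add: mult.commute borel_measurable_indicator)
  finally have "emeasure lborel (T -` X) = emeasure lborel X"
    using B by (metis infinity_ennreal_def mult_divide_eq_ennreal)
  then show "emeasure (distr lborel borel T) X = emeasure lborel X"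
    by (simp add: emeasure_distr)
qed simp

definition standard_gaussian :: "'a::euclidean_space measure" where
  "standard_gaussian = density lborel (\<lambda>x. \<Prod>b\<in>Basis. ennreal (std_normal_density (x \<bullet> b)))"

lemma sets_standard_gaussian [simp, measurable_cong]: "sets standard_gaussian = sets borel"
  by (simp add: standard_gaussian_def)

lemma space_standard_gaussian [simp]: "space standard_gaussian = UNIV"
  by (simp add: standard_gaussian_def)

lemma emeasure_standard_gaussian_box:
  fixes X :: "'a::euclidean_space \<Rightarrow> real set"
  assumes [measurable]: "\<And>b. b \<in> Basis \<Longrightarrow> X b \<in> sets borel"
  shows "emeasure standard_gaussian {x. \<forall>b\<in>Basis. x \<bullet> b \<in> X b}
    = (\<Prod>b\<in>Basis. \<integral>\<^sup>+t. ennreal (std_normal_density t) * indicator (X b) t \<partial>lborel)"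
proof -
  have [measurable]: "{x::'a. \<forall>b\<in>Basis. x \<bullet> b \<in> X b} \<in> sets borel" by measurable
  have "emeasure standard_gaussian {x. \<forall>b\<in>Basis. x \<bullet> b \<in> X b}
      = (\<integral>\<^sup>+x. (\<Prod>b\<in>Basis. ennreal (std_normal_density (x \<bullet> b)))
          * indicator {x. \<forall>b\<in>Basis. x \<bullet> b \<in> X b} x \<partial>lborel)"
    unfolding standard_gaussian_def by (rule emeasure_density) measurable
  also have "\<dots> = (\<integral>\<^sup>+x. (\<Prod>b\<in>Basis. ennreal (std_normal_density (x \<bullet> b)) * indicator (X b) (x \<bullet> b)) \<partial>lborel)"
  proof (rule nn_integral_cong)
    fix x :: 'a
    have "indicator {x. \<forall>b\<in>Basis. x \<bullet> b \<in> X b} x = (\<Prod>b\<in>Basis. indicator (X b) (x \<bullet> b) :: ennreal)"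
      by (auto simp: indicator_def prod_zero_iff)
    then show "(\<Prod>b\<in>Basis. ennreal (std_normal_density (x \<bullet> b)))
          * indicator {x. \<forall>b\<in>Basis. x \<bullet> b \<in> X b} x
        = (\<Prod>b\<in>Basis. ennreal (std_normal_density (x \<bullet> b)) * indicator (X b) (x \<bullet> b))"
      by (simp add: prod.distrib)
  qed
  also have "\<dots> = (\<Prod>b\<in>Basis. \<integral>\<^sup>+t. ennreal (std_normal_density t) * indicator (X b) t \<partial>lborel)"
    by (rule nn_integral_lborel_prod) auto
  finally show ?thesis .
qed

lemma prob_space_standard_gaussian: "prob_space (standard_gaussian :: 'a::euclidean_space measure)"
proof
  have "(\<integral>\<^sup>+t. ennreal (std_normal_density t) \<partial>lborel) = 1"
    using prob_space.emeasure_space_1[OF prob_space_normal_density[of 1 0]]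
    by (simp add: emeasure_density)
  then show "emeasure (standard_gaussian :: 'a measure) (space standard_gaussian) = 1"
    using emeasure_standard_gaussian_box[of "\<lambda>_::'a. UNIV"] by simp
qed

text \<open>
  The product density is a function of the norm alone, and orthogonal maps preserve the norm
  and Lebesgue measure.
\<close>

lemma distr_standard_gaussian_orthogonal_transformation:
  fixes T :: "'a::euclidean_space \<Rightarrow> 'a"
  assumes T: "orthogonal_transformation T"
  shows "distr standard_gaussian borel T = standard_gaussian"
proof (rule measure_eqI)
  have [measurable]: "T \<in> borel_measurable borel"
    by (rule borel_measurable_linear[OF orthogonal_transformation_linear[OF T]])
  define \<phi> where "\<phi> x = (\<Prod>b\<in>Basis. ennreal (std_normal_density (x \<bullet> b)))" for x :: 'a
  have [measurable]: "\<phi> \<in> borel_measurable borel"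
    unfolding \<phi>_def by measurable
  have \<phi>: "\<phi> x = ennreal ((1 / sqrt (2 * pi)) ^ DIM('a) * exp (- (norm x ^ 2 / 2)))" for x
  proof -
    have "norm x ^ 2 = (\<Sum>b\<in>Basis. (x \<bullet> b)\<^sup>2)"
      unfolding power2_norm_eq_inner by (subst euclidean_inner) (simp only: power2_eq_square)
    then have "exp (- (norm x ^ 2 / 2)) = (\<Prod>b\<in>Basis. exp (- (x \<bullet> b)\<^sup>2 / 2))"
      by (simp add: exp_sum[symmetric] sum_negf sum_divide_distrib)
    moreover have "\<phi> x = ennreal (\<Prod>b\<in>Basis. 1 / sqrt (2 * pi) * exp (- (x \<bullet> b)\<^sup>2 / 2))"
      unfolding \<phi>_def std_normal_density_def by (rule prod_ennreal) simp
    ultimately show ?thesis by (simp add: prod_dividef power_one_over)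
  qed
  have \<phi>T: "\<phi> (T x) = \<phi> x" for x
    by (simp add: \<phi> orthogonal_transformation_norm[OF T])
  fix X assume "X \<in> sets (distr standard_gaussian borel T)"
  then have [measurable]: "X \<in> sets borel" by simp
  have [measurable]: "T -` X \<in> sets borel"
    using measurable_sets[of T borel borel X] by simp
  have "emeasure (distr standard_gaussian borel T) X = (\<integral>\<^sup>+x. \<phi> x * indicator (T -` X) x \<partial>lborel)"
    unfolding standard_gaussian_def \<phi>_def[symmetric] by (simp add: emeasure_distr emeasure_density)
  also have "\<dots> = (\<integral>\<^sup>+x. \<phi> (T x) * indicator X (T x) \<partial>lborel)"
    by (simp add: \<phi>T indicator_vimage)
  also have "\<dots> = (\<integral>\<^sup>+x. \<phi> x * indicator X x \<partial>distr lborel borel T)"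
    by (simp add: nn_integral_distr)
  also have "\<dots> = emeasure standard_gaussian X"
    unfolding standard_gaussian_def \<phi>_def[symmetric]
    by (simp add: lborel_distr_orthogonal_transformation[OF T] emeasure_density)
  finally show "emeasure (distr standard_gaussian borel T) X = emeasure standard_gaussian X" .
qed simp

text \<open>
  The canonical basis of the matrix space consists of the matrices with a single entry 1, so
  independence of the entries says that both measures agree on boxes, an intersection stable
  generator of the Borel sets.
\<close>

lemma (in prob_space) gaussian_matrix_distr:
  fixes A :: "'a \<Rightarrow> real ^ 'n::finite ^ 'd::finite"
  assumes "gaussian_matrix M A"
  shows "A \<in> borel_measurable M" and "distr M borel A = standard_gaussian"
proof -
  have ind: "indep_vars (\<lambda>_. borel) (\<lambda>(i, j) \<omega>. A \<omega> $ i $ j) (UNIV :: ('d \<times> 'n) set)"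
    and dist: "distributed M lborel (\<lambda>\<omega>. A \<omega> $ i $ j) (\<lambda>x. ennreal (std_normal_density x))" for i j
    using assms by (auto simp: gaussian_matrix_def)
  have [measurable]: "(\<lambda>\<omega>. A \<omega> $ i $ j) \<in> borel_measurable M" for i j
    using distributed_measurable[OF dist] by simp
  define e :: "'d \<times> 'n \<Rightarrow> real ^ 'n ^ 'd" where "e = (\<lambda>(i, j). axis i (axis j 1))"
  have e: "bij_betw e UNIV Basis"
    by (auto simp: bij_betw_def inj_on_def e_def axis_eq_axis Basis_vec_def)
  have ie: "x \<bullet> e p = x $ fst p $ snd p" for x p
    by (cases p) (simp add: e_def inner_axis)
  show A[measurable]: "A \<in> borel_measurable M"
    by (subst borel_measurable_euclidean_space) (auto simp: Basis_vec_def inner_axis)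
  show "distr M borel A = standard_gaussian"
  proof (rule measure_eqI_generator_eq)
    let ?E = "range (\<lambda>(a, b). box a b :: (real ^ 'n ^ 'd) set)"
    show "Int_stable ?E"
      by (auto simp: Int_stable_def box_Int_box)
    show "?E \<subseteq> Pow UNIV" "sets (distr M borel A) = sigma_sets UNIV ?E"
      "sets (standard_gaussian :: (real ^ 'n ^ 'd) measure) = sigma_sets UNIV ?E"
      by (simp_all add: borel_eq_box)
    let ?B = "\<lambda>n::nat. box (- (real n *\<^sub>R One)) (real n *\<^sub>R One) :: (real ^ 'n ^ 'd) set"
    show "range ?B \<subseteq> ?E" "(\<Union>i. ?B i) = UNIV"
      unfolding UN_box_eq_UNIV by auto
    show "emeasure (distr M borel A) (?B i) \<noteq> \<infinity>" for i
      by (simp add: emeasure_distr)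
    fix X assume "X \<in> ?E"
    then obtain l u where X: "X = box l u" by auto
    define I where "I p = {l \<bullet> e p <..< u \<bullet> e p}" for p
    have "A -` X \<inter> space M = (\<Inter>p\<in>UNIV. (case p of (i, j) \<Rightarrow> \<lambda>\<omega>. A \<omega> $ i $ j) -` I p \<inter> space M)"
      using bij_betw_imp_surj_on[OF e]
      by (auto simp: X mem_box I_def ie split_beta simp flip: bij_betw_imp_surj_on[OF e])
    then have "emeasure (distr M borel A) X
        = emeasure M (\<Inter>p\<in>UNIV. (case p of (i, j) \<Rightarrow> \<lambda>\<omega>. A \<omega> $ i $ j) -` I p \<inter> space M)"
      by (simp add: emeasure_distr X)
    also have "\<dots> = (\<Prod>p\<in>UNIV. emeasure M ((case p of (i, j) \<Rightarrow> \<lambda>\<omega>. A \<omega> $ i $ j) -` I p \<inter> space M))"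
      unfolding emeasure_eq_measure
      by (subst indep_varsD_finite[OF ind]) (auto simp: I_def prod_ennreal)
    also have "\<dots> = (\<Prod>p\<in>UNIV. \<integral>\<^sup>+t. ennreal (std_normal_density t) * indicator (I p) t \<partial>lborel)"
      by (intro prod.cong refl) (auto simp: I_def split_beta intro!: distributed_emeasure[OF dist])
    also have "\<dots> = (\<Prod>b\<in>Basis. \<integral>\<^sup>+t. ennreal (std_normal_density t) * indicator {l \<bullet> b <..< u \<bullet> b} t \<partial>lborel)"
      unfolding I_def by (rule prod.reindex_bij_betw[OF e])
    also have "\<dots> = emeasure standard_gaussian X"
      unfolding X by (subst emeasure_standard_gaussian_box[symmetric]) (auto simp: box_def)
    finally show "emeasure (distr M borel A) X = emeasure standard_gaussian X" .
  qed
qed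

section \<open>Gaussian matrices in general position\<close>

text \<open>
  By translation invariance every \<open>c y\<close> moves \<open>N\<close> to a set of the same measure. Averaging this
  measure over \<open>y\<close> in the unit ball and exchanging the integrals gives the integral over \<open>a\<close> of
  the measures of \<open>{y. a + c y \<in> N}\<close>, which vanish.
\<close>

lemma emeasure_lborel_eq_0_translates:
  fixes N :: "'a::euclidean_space set" and c :: "'b::euclidean_space \<Rightarrow> 'a"
  assumes [measurable]: "N \<in> sets borel" "c \<in> borel_measurable borel"
    and negl: "\<And>a. negligible {y. a + c y \<in> N}"
  shows "emeasure lborel N = 0"
proof -
  let ?B = "ball 0 1 :: 'b set"
  have [measurable]: "?B \<in> sets borel" by simp
  have B: "emeasure lborel ?B \<noteq> 0"
    using content_ball_pos[of 1 "0::'b"] by (auto simp: measure_def)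
  have zero: "(\<integral>\<^sup>+y. indicator ?B y * indicator N (a + c y) \<partial>lborel) = 0" for a
  proof -
    have [measurable]: "{y. a + c y \<in> N} \<in> sets borel" by measurable
    have "{y. a + c y \<in> N} \<in> null_sets lborel"
      using negl[of a] by (simp add: negligible_iff_null_sets null_sets_completion_iff)
    then have "AE y in lborel. a + c y \<notin> N"
      by (auto dest: AE_not_in)
    then show ?thesis
      by (subst nn_integral_0_iff_AE) (auto simp: indicator_def)
  qed
  have "emeasure lborel N * emeasure lborel ?B = (\<integral>\<^sup>+y. indicator ?B y * emeasure lborel N \<partial>lborel)"
    by (subst nn_integral_multc) (simp_all add: mult.commute borel_measurable_indicator)
  also have "\<dots> = (\<integral>\<^sup>+y. \<integral>\<^sup>+a. indicator ?B y * indicator N (a + c y) \<partial>lborel \<partial>lborel)"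
  proof (rule nn_integral_cong)
    fix y
    have "(\<integral>\<^sup>+a. indicator N (a + c y) \<partial>lborel) = (\<integral>\<^sup>+a. indicator N a \<partial>lborel :: ennreal)"
      using nn_integral_lborel_translation[of "indicator N" "c y"] by (simp add: add.commute)
    then show "indicator ?B y * emeasure lborel N
        = (\<integral>\<^sup>+a. indicator ?B y * indicator N (a + c y) \<partial>lborel)"
      by (simp add: nn_integral_cmult)
  qed
  also have "\<dots> = (\<integral>\<^sup>+a. \<integral>\<^sup>+y. indicator ?B y * indicator N (a + c y) \<partial>lborel \<partial>lborel)"
    by (rule pair_sigma_finite.Fubini') (unfold_locales, measurable)
  finally show ?thesis using B by (simp add: zero)
qed

text \<open>
  If \<open>h a\<close> annihilates a nonzero vector of \<open>L\<close>, then after scaling it annihilates some \<open>x\<close> with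
  \<open>x \<bullet> b = 1\<close> for an element \<open>b\<close> of an orthonormal basis. Moving the parameter from \<open>a\<close> to
  \<open>a + c b y\<close> changes \<open>h a x\<close> by exactly \<open>y\<close> on this affine slice. So the bad \<open>y\<close> lie in minus
  the image of the slice, whose dimension is at most \<open>dim L - 1\<close> and hence less than that of the
  target space, so it has measure zero.
  Both \<open>A *v x\<close> and \<open>u v* A\<close> are instances of \<open>h\<close>.
\<close>

lemma AE_standard_gaussian_injective:
  fixes h :: "'a::euclidean_space \<Rightarrow> 'x::euclidean_space \<Rightarrow> 'y::euclidean_space"
  assumes h: "bilinear h"
    and c: "\<And>b. c b \<in> borel_measurable borel" "\<And>b x y. h (c b y) x = (x \<bullet> b) *\<^sub>R y"
    and L: "subspace L" "dim L \<le> DIM('y)"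
  shows "AE a in standard_gaussian. \<forall>x\<in>L. h a x = 0 \<longrightarrow> x = 0"
proof -
  obtain B where B: "B \<subseteq> L" "\<And>b. b \<in> B \<Longrightarrow> norm b = 1" "independent B" "span B = L"
    using orthonormal_basis_subspace[OF L(1)] by metis
  define K where "K b = {x \<in> L. x \<bullet> b = 1}" for b
  define N where "N b = {a. \<exists>x\<in>K b. h a x = 0}" for b
  have cont_h: "continuous_on X (h a)" "continuous_on Y (\<lambda>a. h a x)" for X a Y x
    using h by (auto simp: bilinear_def intro: linear_continuous_on[OF linear_conv_bounded_linear[THEN iffD1]])
  have N_meas: "N b \<in> sets borel" for b
  proof -
    have "closed (K b)"
    proof -
      have "K b = L \<inter> {x. x \<bullet> b = 1}" by (auto simp: K_def)
      then show ?thesis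
        using closed_subspace[OF L(1)] closed_hyperplane[of b 1] by (auto simp: inner_commute)
    qed
    then have "{a\<in>space borel. \<exists>x\<in>K b. h a x = 0} \<in> sets borel"
      by (intro sets_exists_zero_fsigma closed_imp_fsigma_in cont_h)
         (auto intro!: borel_measurable_continuous_onI cont_h)
    then show ?thesis by (simp add: N_def)
  qed
  have "emeasure lborel (N b) = 0" if "b \<in> B" for b
  proof (rule emeasure_lborel_eq_0_translates[OF N_meas c(1)])
    fix a
    let ?L' = "{x \<in> L. x \<bullet> b = 0}"
    have lin: "linear (h a)" using h by (simp add: bilinear_def)
    have b: "b \<in> L" "b \<bullet> b = 1" using B(1,2) that by (auto simp: dot_square_norm)
    have "subspace ?L'"
      using L(1) by (auto simp: subspace_def inner_add_left)
    moreover have "?L' \<subset> L" using b by force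
    ultimately have "dim ?L' < dim L"
      using L(1) by (metis dim_psubset span_eq_iff)
    then have "dim (h a ` ?L') < DIM('y)"
      using dim_image_le[OF lin, of ?L'] L(2) by linarith
    then have "negligible ((+) (- h a b) ` h a ` ?L')"
      by (intro negligible_translation negligible_lowdim)
    moreover have "{y. a + c b y \<in> N b} \<subseteq> (+) (- h a b) ` h a ` ?L'"
    proof
      fix y assume "y \<in> {y. a + c b y \<in> N b}"
      then obtain x where x: "x \<in> L" "x \<bullet> b = 1" "h (a + c b y) x = 0"
        by (auto simp: N_def K_def)
      then have "h a x + y = 0" using c(2)[of b y x] by (simp add: bilinear_ladd[OF h])
      then have "y = - h a b + h a (b - x)"
        by (simp add: linear_diff[OF lin] eq_neg_iff_add_eq_0 add.commute)
      moreover have "b - x \<in> ?L'"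
        using x b L(1) by (auto simp: inner_diff_left subspace_diff)
      ultimately show "y \<in> (+) (- h a b) ` h a ` ?L'" by blast
    qed
    ultimately show "negligible {y. a + c b y \<in> N b}" by (rule negligible_subset)
  qed
  then have AE_N: "AE a in lborel. a \<notin> N b" if "b \<in> B" for b
    using that N_meas by (intro AE_not_in) (auto simp: null_sets_def)
  have "AE a in standard_gaussian. a \<notin> N b" if "b \<in> B" for b
  proof -
    have "AE a in lborel. 0 < (\<Prod>b\<in>Basis. ennreal (std_normal_density (a \<bullet> b))) \<longrightarrow> a \<notin> N b"
      using AE_N[OF that] by eventually_elim simp
    then show ?thesis
      unfolding standard_gaussian_def by (subst AE_density) measurable
  qed
  moreover have "finite B" using B(3) by (rule independent_imp_finite)
  ultimately have "AE a in standard_gaussian. \<forall>b\<in>B. a \<notin> N b"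
    by (simp add: AE_finite_all)
  then show ?thesis
  proof eventually_elim
    case (elim a)
    have lin: "linear (h a)" using h by (simp add: bilinear_def)
    show ?case
    proof (intro ballI impI, rule ccontr)
      fix x assume x: "x \<in> L" "h a x = 0" "x \<noteq> 0"
      have "\<exists>b\<in>B. x \<bullet> b \<noteq> 0"
      proof (rule ccontr)
        assume "\<not> (\<exists>b\<in>B. x \<bullet> b \<noteq> 0)"
        then have "orthogonal x x"
          using x(1) B(4) by (intro orthogonal_to_span[of x B]) (auto simp: orthogonal_def)
        with x(3) show False by (simp add: orthogonal_self)
      qed
      then obtain b where b: "b \<in> B" "x \<bullet> b \<noteq> 0" by auto
      define z where "z = (1 / (x \<bullet> b)) *\<^sub>R x"
      have "z \<in> K b" using x(1) L(1) b(2) by (simp add: K_def z_def subspace_scale)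
      moreover have "h a z = 0" using x(2) by (simp add: z_def linear_scale[OF lin])
      ultimately show False using elim b(1) by (auto simp: N_def)
    qed
  qed
qed

lemma bilinear_matrix_vector_mult:
  "bilinear ((*v) :: real ^ 'n ^ 'd \<Rightarrow> real ^ 'n \<Rightarrow> real ^ 'd)"
  unfolding bilinear_def
  by (auto intro!: linearI simp: matrix_vector_right_distrib matrix_vector_mult_add_rdistrib
      scaleR_matrix_vector_assoc vec.scale matrix_vector_mult_scaleR)

lemma bilinear_vector_matrix_mult:
  "bilinear (\<lambda>(A :: real ^ 'n ^ 'd) u. u v* A)"
  unfolding bilinear_def
  by (auto intro!: linearI simp: vector_matrix_mult_def vec_eq_iff algebra_simps sum.distrib
      sum_distrib_left)

lemma AE_gaussian_matrix_injective_on: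
  fixes L :: "(real ^ 'n) set"
  assumes "subspace L" "dim L \<le> CARD('d::finite)"
  shows "AE A in (standard_gaussian :: (real ^ 'n ^ 'd) measure). \<forall>x\<in>L. A *v x = 0 \<longrightarrow> x = 0"
proof (rule AE_standard_gaussian_injective[where c = "\<lambda>b y. \<chi> i j. y $ i * b $ j"])
  show "(\<lambda>y. \<chi> i j. y $ i * b $ j) \<in> borel_measurable borel" for b :: "real ^ 'n"
    by (intro borel_measurable_linear linearI) (auto simp: vec_eq_iff algebra_simps)
  show "(\<chi> i j. y $ i * b $ j) *v x = (x \<bullet> b) *\<^sub>R y" for b x :: "real ^ 'n" and y :: "real ^ 'd"
    by (auto simp: matrix_vector_mult_def inner_vec_def vec_eq_iff sum_distrib_left sum_distrib_right
        algebra_simps)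
qed (use assms bilinear_matrix_vector_mult in auto)

lemma AE_gaussian_matrix_transpose_injective_on:
  fixes L :: "(real ^ 'd) set"
  assumes "subspace L" "dim L \<le> CARD('n::finite)"
  shows "AE A in (standard_gaussian :: (real ^ 'n ^ 'd) measure). \<forall>u\<in>L. u v* A = 0 \<longrightarrow> u = 0"
proof (rule AE_standard_gaussian_injective[where c = "\<lambda>b y. \<chi> i j. b $ i * y $ j"])
  show "(\<lambda>y. \<chi> i j. b $ i * y $ j) \<in> borel_measurable borel" for b :: "real ^ 'd"
    by (intro borel_measurable_linear linearI) (auto simp: vec_eq_iff algebra_simps)
  show "u v* (\<chi> i j. b $ i * y $ j) = (u \<bullet> b) *\<^sub>R y" for b u :: "real ^ 'd" and y :: "real ^ 'n"
    by (auto simp: vector_matrix_mult_def inner_vec_def vec_eq_iff sum_distrib_left sum_distrib_right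
        algebra_simps)
qed (use assms bilinear_vector_matrix_mult in auto)

section \<open>A random orthogonal transformation\<close>

text \<open>
  Isometries between the subspaces and between their orthogonal complements combine to an
  orthogonal map. It expresses that the orthogonal group acts transitively on the Grassmannian.
\<close>

lemma orthogonal_transformation_between_subspaces:
  fixes V W :: "'a::euclidean_space set"
  assumes V: "subspace V" and W: "subspace W" and dim: "dim V = dim W"
  obtains T :: "'a \<Rightarrow> 'a" where "orthogonal_transformation T" "T ` V = W"
proof -
  define V' where "V' = {y \<in> UNIV. \<forall>x\<in>V. orthogonal x y}"
  define W' where "W' = {y \<in> UNIV. \<forall>x\<in>W. orthogonal x y}"
  have "subspace V'" "subspace W'"
    unfolding V'_def W'_def by (auto simp: subspace_def orthogonal_clauses)
  moreover have "dim V' = dim W'"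
    using dim_subspace_orthogonal_to_vectors[OF V subspace_UNIV]
      dim_subspace_orthogonal_to_vectors[OF W subspace_UNIV] dim
    unfolding V'_def W'_def by simp
  ultimately obtain g where g: "linear g" "g ` V' = W'" "\<And>x. x \<in> V' \<Longrightarrow> norm (g x) = norm x"
    by (metis isometry_subspaces)
  obtain f where f: "linear f" "f ` V = W" "\<And>x. x \<in> V \<Longrightarrow> norm (f x) = norm x"
    using isometry_subspaces[OF V W dim] by metis
  let ?P = "closest_point V"
  note P = linear_closest_point_subspace[OF V]
  define T where "T x = f (?P x) + g (x - ?P x)" for x
  have lin: "linear T"
    by (rule linearI)
       (simp_all add: T_def linear_add[OF P] linear_scale[OF P] linear_add[OF f(1)] linear_add[OF g(1)]
        linear_scale[OF f(1)] linear_scale[OF g(1)] linear_diff[OF g(1)] algebra_simps)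
  have "norm (T x) = norm x" for x
  proof -
    have 1: "?P x \<in> V" by (rule closest_point_subspace(1)[OF V])
    have 2: "x - ?P x \<in> V'"
      using closest_point_subspace(2)[OF V] by (auto simp: V'_def orthogonal_def inner_commute)
    have "f (?P x) \<in> W" "g (x - ?P x) \<in> W'" using 1 2 f(2) g(2) by auto
    then have "orthogonal (f (?P x)) (g (x - ?P x))" by (auto simp: W'_def)
    then have "norm (T x) ^ 2 = norm (?P x) ^ 2 + norm (x - ?P x) ^ 2"
      using f(3)[OF 1] g(3)[OF 2] norm_add_Pythagorean[of "f (?P x)" "g (x - ?P x)"] by (simp add: T_def)
    also have "\<dots> = norm (?P x + (x - ?P x)) ^ 2"
      using 1 2 by (intro norm_add_Pythagorean[symmetric]) (auto simp: V'_def)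
    finally show ?thesis by simp
  qed
  then have "orthogonal_transformation T"
    using lin by (simp add: orthogonal_transformation)
  moreover have "T x = f x" if "x \<in> V" for x
    using that closest_point_subspace_refl[OF V, of x] linear_0[OF g(1)] by (simp add: T_def)
  then have "T ` V = W" using f(2) by force
  ultimately show ?thesis by (rule that)
qed

text \<open>
  Together with rotation invariance of the Gaussian measure on the matrix space, this shows that
  applying an orthogonal map to each row of a Gaussian matrix does not change its distribution.
\<close>

lemma orthogonal_transformation_rows:
  fixes T :: "real ^ 'n \<Rightarrow> real ^ 'n"
  assumes "orthogonal_transformation T"
  shows "orthogonal_transformation (\<lambda>A :: real ^ 'n ^ 'd. \<chi> i. T (A $ i))"
proof -
  have lin: "linear T" using assms by (rule orthogonal_transformation_linear)
  have "linear (\<lambda>A :: real ^ 'n ^ 'd. \<chi> i. T (A $ i))"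
    by (rule linearI) (auto simp: vec_eq_iff[where 'a = "real ^ 'n"] linear_add[OF lin] linear_scale[OF lin])
  then show ?thesis
    using assms by (auto simp: orthogonal_transformation_def inner_vec_def[where 'a = "real ^ 'n"])
qed

lemma vector_matrix_mult_rows:
  "u v* A = (\<Sum>i\<in>UNIV. u $ i *\<^sub>R A $ i)" for A :: "real ^ 'n ^ 'd"
  by (auto simp: vector_matrix_mult_def vec_eq_iff mult.commute)

lemma vector_matrix_mult_orthogonal_rows:
  fixes A :: "real ^ 'n ^ 'd"
  assumes "orthogonal_transformation T"
  shows "u v* (\<chi> i. T (A $ i)) = T (u v* A)"
  using orthogonal_transformation_linear[OF assms]
  by (simp add: vector_matrix_mult_rows linear_sum linear_scale)

lemma matrix_vector_mult_orthogonal_rows: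
  fixes A :: "real ^ 'n ^ 'd"
  assumes "orthogonal_transformation T"
  shows "(\<chi> i. T (A $ i)) *v T x = A *v x"
  using assms by (simp add: vec_eq_iff matrix_vector_mul_component orthogonal_transformation_def)

lemma orthonormal_sequence_subspace:
  fixes L :: "'a::euclidean_space set"
  assumes "subspace L"
  obtains u :: "nat \<Rightarrow> 'a" where "span (u ` {..<dim L}) = L"
    "\<And>i j. i < dim L \<Longrightarrow> j < dim L \<Longrightarrow> u i \<bullet> u j = (if i = j then 1 else 0)"
proof -
  obtain B where B: "pairwise orthogonal B" "\<And>x. x \<in> B \<Longrightarrow> norm x = 1" "independent B"
    "card B = dim L" "span B = L"
    using orthonormal_basis_subspace[OF assms] by metis
  then obtain u where u: "bij_betw u {..<dim L} B"
    by (metis ex_bij_betw_nat_finite independent_imp_finite lessThan_atLeast0)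
  show ?thesis
  proof
    show "span (u ` {..<dim L}) = L" using u B(5) by (simp add: bij_betw_def)
    show "u i \<bullet> u j = (if i = j then 1 else 0)" if "i < dim L" "j < dim L" for i j
    proof (cases "i = j")
      case True
      then show ?thesis using that u B(2) by (auto simp: bij_betw_def dot_square_norm)
    next
      case False
      then have "u i \<noteq> u j" using that u by (auto simp: bij_betw_def inj_on_def)
      moreover have "u i \<in> B" "u j \<in> B" using that u by (auto simp: bij_betw_def)
      ultimately show ?thesis using B(1) False by (auto simp: pairwise_def orthogonal_def)
    qed
  qed
qed

lemma AE_gaussian_dim_rows:
  fixes u :: "nat \<Rightarrow> real ^ 'd"
  assumes "dim (u ` {..<k}) = k" "k \<le> CARD('n::finite)"
  shows "AE A in (standard_gaussian :: (real ^ 'n ^ 'd) measure). dim ((\<lambda>i. u i v* A) ` {..<k}) = k"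
proof -
  have "AE A in (standard_gaussian :: (real ^ 'n ^ 'd) measure).
      \<forall>x\<in>span (u ` {..<k}). x v* A = 0 \<longrightarrow> x = 0"
    using assms by (intro AE_gaussian_matrix_transpose_injective_on) auto
  then show ?thesis
  proof eventually_elim
    case (elim A)
    have lin: "linear (\<lambda>x. x v* A)"
      using bilinear_vector_matrix_mult[where 'n='n and 'd='d] by (simp add: bilinear_def)
    have "inj_on (\<lambda>x. x v* A) (span (u ` {..<k}))"
    proof (rule inj_onI)
      fix x y assume "x \<in> span (u ` {..<k})" "y \<in> span (u ` {..<k})" "x v* A = y v* A"
      then show "x = y"
        using elim[rule_format, of "x - y"] by (simp add: span_diff linear_diff[OF lin])
    qed
    then have "dim ((\<lambda>x. x v* A) ` u ` {..<k}) = dim (u ` {..<k})"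
      by (rule dim_image_eq[OF lin])
    then show ?case using assms(1) by (simp add: image_image)
  qed
qed

lemma borel_measurable_vector_matrix_mult [measurable]:
  "(\<lambda>A :: real ^ 'n ^ 'd. u v* A) \<in> borel_measurable borel"
  using bilinear_vector_matrix_mult[where 'n='n and 'd='d]
  by (intro borel_measurable_linear) (simp add: bilinear_def)

text \<open>
  This plays the role of Haar measure on the orthogonal group. The Gram-Schmidt frame \<open>g A\<close> of the
  rows of a square Gaussian matrix defines an orthogonal map \<open>Q A\<close> that sends a fixed orthonormal
  basis \<open>e\<close> to \<open>g A\<close>, and rotating the rows by \<open>T\<close> replaces \<open>Q A\<close> by \<open>T \<circ> Q A\<close>. The map \<open>R A\<close> is the
  inverse of \<open>Q A\<close>, so that the rotation acts from the right: \<open>R A \<circ> T\<close> and \<open>R A\<close> have the same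
  distribution. On the null set of singular matrices \<open>R A\<close> is set to the identity.
\<close>

lemma exists_random_orthogonal_transformation:
  obtains R :: "real ^ 'n::finite ^ 'n \<Rightarrow> real ^ 'n \<Rightarrow> real ^ 'n" where
    "\<And>A. orthogonal_transformation (R A)"
    "\<And>x. (\<lambda>A. R A x) \<in> borel_measurable borel"
    "\<And>x. (\<lambda>A. inv (R A) x) \<in> borel_measurable borel"
    "\<And>T. orthogonal_transformation T \<Longrightarrow>
      AE A in standard_gaussian. \<forall>x. R (\<chi> i. T (A $ i)) (T x) = R A x"
proof -
  let ?n = "CARD('n)"
  have dU: "dim (UNIV :: (real ^ 'n) set) = ?n" by simp
  obtain e :: "nat \<Rightarrow> real ^ 'n" where span_e: "span (e ` {..<?n}) = UNIV"
    and e: "\<And>i j. i < ?n \<Longrightarrow> j < ?n \<Longrightarrow> e i \<bullet> e j = (if i = j then 1 else 0)"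
    using orthonormal_sequence_subspace[OF subspace_UNIV, where 'a="real ^ 'n"] unfolding dU by metis
  define g where "g A i = gram_schmidt (\<lambda>i. e i v* A) i" for A :: "real ^ 'n ^ 'n" and i
  define good where "good = {A. \<forall>i<?n. g A i \<noteq> 0}"
  define R where "R A x = (if A \<in> good then \<Sum>i<?n. (x \<bullet> g A i) *\<^sub>R e i else x)"
    for A :: "real ^ 'n ^ 'n" and x
  define Q where "Q A x = (if A \<in> good then \<Sum>i<?n. (x \<bullet> e i) *\<^sub>R g A i else x)"
    for A :: "real ^ 'n ^ 'n" and x
  have g_meas [measurable]: "(\<lambda>A. g A i) \<in> borel_measurable borel" for i
    unfolding g_def by measurable
  have [measurable]: "good \<in> sets borel"
    unfolding good_def by measurable
  have g: "g A i \<bullet> g A j = (if i = j then 1 else 0)" if "A \<in> good" "i < ?n" "j < ?n" for A i j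
    using that unfolding good_def g_def
    by (cases "i = j") (auto simp: gram_schmidt_norm gram_schmidt_orthogonal)
  have delta: "(\<Sum>j<?n. (a j * (if i = j then 1 else 0))) = a i" if "i < ?n" for a :: "nat \<Rightarrow> real" and i
    using that by (simp add: if_distrib[of "\<lambda>x. _ * x"] cong: if_cong)
  \<comment> \<open>Parseval expansion, used for the fixed basis \<open>e\<close> and for the random frame \<open>g A\<close>.\<close>
  have expand: "(\<Sum>i<?n. (x \<bullet> f i) *\<^sub>R f i) = x"
    if "span (f ` {..<?n}) = UNIV" and f: "\<And>i j. i < ?n \<Longrightarrow> j < ?n \<Longrightarrow> f i \<bullet> f j = (if i = j then 1 else 0)"
    for x :: "real ^ 'n" and f :: "nat \<Rightarrow> real ^ 'n"
  proof -
    let ?y = "x - (\<Sum>i<?n. (x \<bullet> f i) *\<^sub>R f i)"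
    have "orthogonal ?y z" if "z \<in> f ` {..<?n}" for z
    proof -
      obtain i where i: "i < ?n" "z = f i" using \<open>z \<in> f ` {..<?n}\<close> by auto
      have "(\<Sum>j<?n. (x \<bullet> f j) *\<^sub>R f j) \<bullet> f i = (\<Sum>j<?n. (x \<bullet> f j) * (if i = j then 1 else 0))"
        unfolding inner_sum_left by (intro sum.cong refl) (use i f in \<open>auto simp: inner_commute\<close>)
      then show ?thesis using delta[OF i(1)] i(2) by (simp add: orthogonal_def inner_diff_left)
    qed
    then have "orthogonal ?y ?y"
      using that(1) by (intro orthogonal_to_span[of ?y "f ` {..<?n}"]) auto
    then show ?thesis by (simp add: orthogonal_self)
  qed
  have QR: "Q A (R A x) = x" "R A (Q A x) = x" "norm (R A x) = norm x" for A x
  proof -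
    have *: "Q A (R A x) = x \<and> R A (Q A x) = x \<and> norm (R A x) = norm x" if A: "A \<in> good"
    proof -
      have "dim (g A ` {..<?n}) = ?n"
      proof -
        have "dim (g A ` {..<?n}) = dim ((\<lambda>i. e i v* A) ` {..<?n})"
          unfolding g_def by (metis dim_span span_gram_schmidt)
        also have "\<dots> = card {i\<in>{..<?n}. g A i \<noteq> 0}"
          unfolding g_def by (rule dim_span_gram_schmidt)
        also have "{i\<in>{..<?n}. g A i \<noteq> 0} = {..<?n}" using A by (auto simp: good_def)
        finally show ?thesis by simp
      qed
      then have span_g: "span (g A ` {..<?n}) = UNIV"
        using dim_eq_full[of "g A ` {..<?n}"] by simp
      have 1: "R A x \<bullet> e i = x \<bullet> g A i" if "i < ?n" for x i
        using that A e delta[OF that, of "\<lambda>j. x \<bullet> g A j"] by (simp add: R_def inner_sum_left)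
           (smt (verit, best) delta[OF that, of "\<lambda>j. x \<bullet> g A j"] lessThan_iff sum.cong)
      have 2: "Q A x \<bullet> g A i = x \<bullet> e i" if "i < ?n" for x i
        using that A g[OF A] delta[OF that, of "\<lambda>j. x \<bullet> e j"] by (simp add: Q_def inner_sum_left)
           (smt (verit, best) delta[OF that, of "\<lambda>j. x \<bullet> e j"] lessThan_iff sum.cong)
      have 3: "Q A (R A x) = x" for x
        using A expand[OF span_g g[OF A]] by (simp add: Q_def 1)
      have 4: "R A (Q A x) = x" for x
        using A expand[OF span_e e] by (simp add: R_def 2)
      have "R A x \<bullet> R A x = x \<bullet> x"
      proof -
        have "R A x \<bullet> R A x = (\<Sum>i<?n. (x \<bullet> g A i) *\<^sub>R e i) \<bullet> R A x"
          using A by (simp add: R_def)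
        also have "\<dots> = (\<Sum>i<?n. (x \<bullet> g A i) *\<^sub>R g A i) \<bullet> x"
          by (simp add: inner_sum_left 1 inner_commute[of "e _"] inner_commute[of "g A _"])
        finally show ?thesis by (simp add: expand[OF span_g g[OF A]])
      qed
      then show ?thesis using 3 4 by (simp add: norm_eq)
    qed
    show "Q A (R A x) = x" "R A (Q A x) = x" "norm (R A x) = norm x"
      using * by (cases "A \<in> good"; simp add: Q_def R_def)+
  qed
  have linR: "linear (R A)" for A
    by (rule linearI) (auto simp: R_def inner_add_left scaleR_add_left sum.distrib scaleR_sum_right)
  have invR: "inv (R A) = Q A" for A
    by (rule inv_equality) (simp_all add: QR)
  show ?thesis
  proof
    show "orthogonal_transformation (R A)" for A
      using linR QR(3) by (simp add: orthogonal_transformation)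
    show "(\<lambda>A. R A x) \<in> borel_measurable borel" for x
      unfolding R_def by measurable
    show "(\<lambda>A. inv (R A) x) \<in> borel_measurable borel" for x
      unfolding invR unfolding Q_def by measurable
    fix T :: "real ^ 'n \<Rightarrow> real ^ 'n" assume T: "orthogonal_transformation T"
    have "dim (e ` {..<?n}) = ?n" using span_e dim_span[of "e ` {..<?n}"] by simp
    then have "AE A in (standard_gaussian :: (real ^ 'n ^ 'n) measure).
        dim ((\<lambda>i. e i v* A) ` {..<?n}) = ?n"
      by (intro AE_gaussian_dim_rows) auto
    then show "AE A in standard_gaussian. \<forall>x. R (\<chi> i. T (A $ i)) (T x) = R A x"
    proof eventually_elim
      case (elim A)
      then have A: "A \<in> good"
        by (auto simp: good_def g_def gram_schmidt_nonzero)
      have gT: "g (\<chi> i. T (A $ i)) i = T (g A i)" for i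
        unfolding g_def vector_matrix_mult_orthogonal_rows[OF T] by (rule gram_schmidt_equivariant[OF T])
      then have "(\<chi> i. T (A $ i)) \<in> good"
        using A orthogonal_transformation_norm[OF T] by (auto simp: good_def) (metis norm_eq_zero)
      then show ?case
        using A T by (simp add: R_def gT orthogonal_transformation_def)
    qed
  qed
qed

section \<open>The uniform distribution on the Grassmannian\<close>

text \<open>
  The property whose unique solution \<^const>\<open>uniform_Grassmannian\<close> denotes. That constant is a
  definite description, so nothing is known about it before existence and uniqueness are proved.
\<close>

definition is_uniform_Grassmannian :: "nat \<Rightarrow> 'a::euclidean_space set measure \<Rightarrow> bool" where
  "is_uniform_Grassmannian m \<nu> \<longleftrightarrow> prob_space \<nu> \<and> space \<nu> = Grassmannian m \<and>
     sets \<nu> = sets (Grassmannian_borel m) \<and> rotation_invariant \<nu>"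

lemma measurable_orthogonal_image_const:
  fixes T :: "'a::euclidean_space \<Rightarrow> 'a"
  assumes "orthogonal_transformation T"
  shows "(\<lambda>W. T ` W) \<in> Grassmannian_borel m \<rightarrow>\<^sub>M Grassmannian_borel m"
  by (rule measurable_orthogonal_image[where V = "\<lambda>W. W"]) (auto simp: assms)

text \<open>
  Let \<open>\<mu>\<close> be an invariant probability measure and \<open>R\<close> a random orthogonal map as above. By
  invariance, \<open>\<mu> S\<close> is the integral over \<open>A\<close> of the \<open>\<mu>\<close>-probability that \<open>R A ` W \<in> S\<close>. Exchanging the
  integrals gives the \<open>\<mu>\<close>-average of the probability \<open>c S W\<close> that the random subspace
  \<open>R A ` W\<close> is in \<open>S\<close>. Since \<open>R A \<circ> T\<close> is distributed like \<open>R A\<close> and rotations act transitively,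
  \<open>c S W\<close> does not depend on \<open>W\<close>; hence \<open>\<mu> S = c S W\<close>, which no longer mentions \<open>\<mu>\<close>.
\<close>

lemma is_uniform_Grassmannian_unique:
  fixes \<nu> \<nu>' :: "(real ^ 'n) set measure"
  assumes "is_uniform_Grassmannian m \<nu>" "is_uniform_Grassmannian m \<nu>'"
  shows "\<nu> = \<nu>'"
proof -
  obtain R :: "real ^ 'n ^ 'n \<Rightarrow> real ^ 'n \<Rightarrow> real ^ 'n" where
    orth: "\<And>A. orthogonal_transformation (R A)"
    and R_meas: "\<And>x. (\<lambda>A. R A x) \<in> borel_measurable borel"
    and inv_meas: "\<And>x. (\<lambda>A. inv (R A) x) \<in> borel_measurable borel"
    and equi: "\<And>T. orthogonal_transformation T \<Longrightarrow>
      AE A in standard_gaussian. \<forall>x. R (\<chi> i. T (A $ i)) (T x) = R A x"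
    by (rule exists_random_orthogonal_transformation, rule that)
  let ?\<Gamma> = "standard_gaussian :: (real ^ 'n ^ 'n) measure"
  interpret \<Gamma>: prob_space ?\<Gamma> by (rule prob_space_standard_gaussian)
  have image_meas: "(\<lambda>s. R (a s) ` V s) \<in> S \<rightarrow>\<^sub>M Grassmannian_borel m"
    if a: "a \<in> borel_measurable S" and V: "V \<in> S \<rightarrow>\<^sub>M Grassmannian_borel m"
    for S :: "'s measure" and a and V :: "'s \<Rightarrow> (real ^ 'n) set"
    using measurable_compose[OF a R_meas] measurable_compose[OF a inv_meas] V
    by (intro measurable_orthogonal_image orth) auto
  define c where "c S W = (\<integral>\<^sup>+A. indicator S (R A ` W) \<partial>?\<Gamma>)" for S and W :: "(real ^ 'n) set"
  have c_const: "c S V = c S W"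
    if V: "V \<in> Grassmannian m" and W: "W \<in> Grassmannian m" and S[measurable]: "S \<in> sets (Grassmannian_borel m)" for S V W
  proof -
    obtain T where T: "orthogonal_transformation T" "T ` V = W"
      using V W orthogonal_transformation_between_subspaces[of V W] by (auto simp: Grassmannian_def)
    let ?rot = "\<lambda>A :: real ^ 'n ^ 'n. \<chi> i. T (A $ i)"
    have rot: "orthogonal_transformation ?rot"
      by (rule orthogonal_transformation_rows[OF T(1)])
    have [measurable]: "?rot \<in> borel_measurable borel"
      by (rule borel_measurable_linear[OF orthogonal_transformation_linear[OF rot]])
    have "(\<lambda>A. R A ` W) \<in> borel \<rightarrow>\<^sub>M Grassmannian_borel m"
      using W by (intro image_meas) auto
    then have [measurable]: "(\<lambda>A. indicator S (R A ` W) :: ennreal) \<in> borel_measurable borel"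
      by measurable
    have "c S W = (\<integral>\<^sup>+A. indicator S (R A ` W) \<partial>distr ?\<Gamma> borel ?rot)"
      unfolding c_def distr_standard_gaussian_orthogonal_transformation[OF rot] ..
    also have "\<dots> = (\<integral>\<^sup>+A. indicator S (R (?rot A) ` W) \<partial>?\<Gamma>)"
      by (rule nn_integral_distr) measurable
    also have "\<dots> = c S V"
      unfolding c_def
    proof (rule nn_integral_cong_AE)
      show "AE A in ?\<Gamma>. (indicator S (R (?rot A) ` W) :: ennreal) = indicator S (R A ` V)"
        using equi[OF T(1)] by eventually_elim (simp add: T(2)[symmetric] image_image)
    qed
    finally show ?thesis by simp
  qed
  have key: "emeasure \<mu> S = c S V"
    if \<mu>: "is_uniform_Grassmannian m \<mu>" and V: "V \<in> Grassmannian m" and S: "S \<in> sets (Grassmannian_borel m)"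
    for \<mu> S V
  proof -
    interpret \<mu>: prob_space \<mu> using \<mu> by (simp add: is_uniform_Grassmannian_def)
    interpret pair_prob_space ?\<Gamma> \<mu> ..
    have sets_\<mu> [measurable_cong]: "sets \<mu> = sets (Grassmannian_borel m)"
      and space_\<mu>: "space \<mu> = Grassmannian m"
      using \<mu> by (auto simp: is_uniform_Grassmannian_def)
    note [measurable] = S
    have inv: "(\<integral>\<^sup>+W. indicator S (R A ` W) \<partial>\<mu>) = emeasure \<mu> S" for A
    proof -
      have [measurable]: "(\<lambda>W. R A ` W) \<in> \<mu> \<rightarrow>\<^sub>M \<mu>"
        using measurable_orthogonal_image_const[OF orth] by measurable
      have "distr \<mu> \<mu> (\<lambda>W. R A ` W) = \<mu>"
        using \<mu> orth by (simp add: is_uniform_Grassmannian_def rotation_invariant_def)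
      then have "emeasure \<mu> S = (\<integral>\<^sup>+W. indicator S W \<partial>distr \<mu> \<mu> (\<lambda>W. R A ` W))"
        using S by (simp add: sets_\<mu>)
      also have "\<dots> = (\<integral>\<^sup>+W. indicator S (R A ` W) \<partial>\<mu>)"
        by (rule nn_integral_distr) measurable
      finally show ?thesis by simp
    qed
    have [measurable]: "(\<lambda>(A, W). indicator S (R A ` W) :: ennreal) \<in> borel_measurable (?\<Gamma> \<Otimes>\<^sub>M \<mu>)"
    proof -
      have "(\<lambda>s. R (fst s) ` snd s) \<in> ?\<Gamma> \<Otimes>\<^sub>M \<mu> \<rightarrow>\<^sub>M Grassmannian_borel m"
        by (rule image_meas) measurable
      then show ?thesis unfolding split_beta by measurable
    qed
    have "emeasure \<mu> S = (\<integral>\<^sup>+A. \<integral>\<^sup>+W. indicator S (R A ` W) \<partial>\<mu> \<partial>?\<Gamma>)"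
      using \<Gamma>.emeasure_space_1 by (simp add: inv)
    also have "\<dots> = (\<integral>\<^sup>+W. c S W \<partial>\<mu>)"
      unfolding c_def by (rule Fubini'[symmetric]) measurable
    also have "\<dots> = (\<integral>\<^sup>+W. c S V \<partial>\<mu>)"
      by (rule nn_integral_cong) (use c_const[OF _ V S] space_\<mu> in auto)
    finally show ?thesis by (simp add: \<mu>.emeasure_space_1)
  qed
  obtain V where V: "V \<in> (Grassmannian m :: (real ^ 'n) set set)"
    using assms(1) prob_space.not_empty[of \<nu>] by (auto simp: is_uniform_Grassmannian_def)
  show ?thesis
  proof (rule measure_eqI)
    show "sets \<nu> = sets \<nu>'" using assms by (simp add: is_uniform_Grassmannian_def)
    fix S assume "S \<in> sets \<nu>"
    then have "S \<in> sets (Grassmannian_borel m)" using assms(1) by (simp add: is_uniform_Grassmannian_def)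
    then show "emeasure \<nu> S = emeasure \<nu>' S"
      using key[OF assms(1) V] key[OF assms(2) V] by simp
  qed
qed

lemma uniform_Grassmannian_eqI:
  fixes \<nu> :: "(real ^ 'n) set measure"
  assumes "is_uniform_Grassmannian m \<nu>"
  shows "uniform_Grassmannian m = \<nu>"
proof -
  have "uniform_Grassmannian m = (THE \<nu>. is_uniform_Grassmannian m (\<nu> :: (real ^ 'n) set measure))"
    by (simp add: uniform_Grassmannian_def is_uniform_Grassmannian_def)
  also have "\<dots> = \<nu>"
    using assms is_uniform_Grassmannian_unique by (blast intro: the_equality)
  finally show ?thesis .
qed

text \<open>
  The preimage of \<open>W\<close> under \<open>A\<close> is the orthogonal complement of the \<open>k\<close> Gaussian vectors \<open>u i v* A\<close>,
  where the \<open>u i\<close> span the complement of \<open>W\<close>. These vectors are almost surely independent, so the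
  preimage has codimension \<open>k\<close>. Rotating the rows of \<open>A\<close> rotates the preimage, so its distribution
  is invariant. The map \<open>V\<close> equals the preimage except on a null set, where it takes a fixed value
  in the Grassmannian. For \<open>W = {0}\<close> this is the kernel of \<open>A\<close>.
\<close>

lemma gaussian_preimage_subspace_uniform:
  fixes W :: "(real ^ 'd) set"
  assumes W: "subspace W" and k: "dim W + k = CARD('d)" "k \<le> CARD('n)"
  obtains V :: "real ^ 'n ^ 'd \<Rightarrow> (real ^ 'n) set" where
    "V \<in> borel \<rightarrow>\<^sub>M Grassmannian_borel (CARD('n) - k)"
    "AE A in standard_gaussian. V A = {x. A *v x \<in> W}"
    "is_uniform_Grassmannian (CARD('n) - k)
       (distr standard_gaussian (Grassmannian_borel (CARD('n) - k)) V)"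
proof -
  let ?\<Gamma> = "standard_gaussian :: (real ^ 'n ^ 'd) measure" and ?m = "CARD('n) - k"
  interpret \<Gamma>: prob_space ?\<Gamma> by (rule prob_space_standard_gaussian)
  define W' where "W' = {y \<in> UNIV. \<forall>x\<in>W. orthogonal x y}"
  have W': "subspace W'"
    unfolding W'_def by (auto simp: subspace_def orthogonal_clauses)
  have dim_W': "dim W' = k"
    using dim_subspace_orthogonal_to_vectors[OF W subspace_UNIV] k(1) unfolding W'_def by simp
  obtain u where u: "span (u ` {..<k}) = W'"
    using orthonormal_sequence_subspace[OF W'] unfolding dim_W' by metis
  have W_eq: "y \<in> W \<longleftrightarrow> (\<forall>i<k. u i \<bullet> y = 0)" for y
  proof
    assume "y \<in> W"
    then have "orthogonal y z" if "z \<in> W'" for z using that by (auto simp: W'_def)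
    moreover have "u i \<in> W'" if "i < k" for i using that u by (auto intro: span_base)
    ultimately show "\<forall>i<k. u i \<bullet> y = 0" by (metis orthogonal_def inner_commute)
  next
    assume y: "\<forall>i<k. u i \<bullet> y = 0"
    let ?z = "y - closest_point W y"
    have z: "?z \<in> W'" 
      using closest_point_subspace(2)[OF W] by (auto simp: W'_def orthogonal_def inner_commute)
    have "orthogonal y x" if "x \<in> u ` {..<k}" for x
      using y that by (auto simp: orthogonal_def inner_commute)
    then have "orthogonal y ?z" using z u by (auto intro: orthogonal_to_span)
    moreover have "orthogonal (closest_point W y) ?z"
      using closest_point_subspace[OF W] by (simp add: orthogonal_def inner_commute)
    ultimately have "orthogonal ?z ?z" by (simp add: orthogonal_clauses)
    then show "y \<in> W" using closest_point_subspace_refl[OF W, of y] by (simp add: orthogonal_self)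
  qed
  define v where "v A i = u i v* A" for A :: "real ^ 'n ^ 'd" and i
  define V0 where "V0 A = {x. \<forall>i<k. v A i \<bullet> x = 0}" for A
  define good where "good = {A. dim (v A ` {..<k}) = k}"
  obtain D where D: "D \<in> (Grassmannian ?m :: (real ^ 'n) set set)"
    using choose_subspace_of_subspace[of ?m "UNIV :: (real ^ 'n) set"]
    by (auto simp: Grassmannian_def)
  define V where "V A = (if A \<in> good then V0 A else D)" for A
  have V0: "V0 A = {x. A *v x \<in> W}" for A
    by (auto simp: V0_def v_def W_eq dot_lmul_matrix)
  have AE_good: "AE A in ?\<Gamma>. A \<in> good"
    using AE_gaussian_dim_rows[of u k, where 'n='n] u dim_W' k(2) dim_span[of "u ` {..<k}"]
    by (simp add: good_def v_def)
  have V_in: "V A \<in> Grassmannian ?m" for A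
  proof (cases "A \<in> good")
    case True
    let ?S = "span (v A ` {..<k})"
    have "V0 A = {y \<in> UNIV. \<forall>x\<in>?S. orthogonal x y}"
    proof -
      have "(\<forall>i<k. v A i \<bullet> x = 0) \<longleftrightarrow> (\<forall>z\<in>?S. orthogonal x z)" for x
      proof
        assume "\<forall>i<k. v A i \<bullet> x = 0"
        then have "orthogonal x z" if "z \<in> v A ` {..<k}" for z
          using that by (auto simp: orthogonal_def inner_commute)
        then show "\<forall>z\<in>?S. orthogonal x z" by (meson orthogonal_to_span)
      qed (auto simp: orthogonal_def inner_commute span_base)
      then show ?thesis by (auto simp: V0_def orthogonal_commute)
    qed
    moreover have "dim {y \<in> UNIV. \<forall>x\<in>?S. orthogonal x y} + dim ?S = CARD('n)"
      using dim_subspace_orthogonal_to_vectors[of ?S UNIV] by simp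
    moreover have "dim ?S = k" using True by (simp add: good_def)
    ultimately have "dim (V0 A) = ?m" by simp
    moreover have "subspace (V0 A)" by (auto simp: V0_def subspace_def inner_add_right)
    ultimately show ?thesis using True by (simp add: V_def Grassmannian_def)
  qed (use D in \<open>simp add: V_def\<close>)
  have [measurable]: "(\<lambda>A. v A i) \<in> borel_measurable borel" for i
    unfolding v_def by measurable
  have good_eq: "good = {A. \<forall>i<k. gram_schmidt (v A) i \<noteq> 0}"
  proof -
    have "(card {i\<in>{..<k}. gram_schmidt (v A) i \<noteq> 0} = k) \<longleftrightarrow> (\<forall>i<k. gram_schmidt (v A) i \<noteq> 0)" for A
    proof
      assume "card {i\<in>{..<k}. gram_schmidt (v A) i \<noteq> 0} = k"
      then have "dim (v A ` {..<k}) = k"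
        by (simp only: dim_span_gram_schmidt)
      then show "\<forall>i<k. gram_schmidt (v A) i \<noteq> 0"
        by (intro allI impI gram_schmidt_nonzero)
    next
      assume "\<forall>i<k. gram_schmidt (v A) i \<noteq> 0"
      then have "{i\<in>{..<k}. gram_schmidt (v A) i \<noteq> 0} = {..<k}" by auto
      then show "card {i\<in>{..<k}. gram_schmidt (v A) i \<noteq> 0} = k" by simp
    qed
    then show ?thesis by (simp add: good_def dim_span_gram_schmidt)
  qed
  have [measurable]: "good \<in> sets borel"
    unfolding good_eq by measurable
  have V_meas [measurable]: "V \<in> borel \<rightarrow>\<^sub>M Grassmannian_borel ?m"
  proof (rule measurable_Grassmannian_borelI)
    fix x
    have "closest_point (V A) x = (if A \<in> good
        then x - (\<Sum>i<k. (x \<bullet> gram_schmidt (v A) i) *\<^sub>R gram_schmidt (v A) i) else closest_point D x)" for A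
      by (simp add: V_def V0_def closest_point_orthogonal_complement)
    then show "(\<lambda>A. closest_point (V A) x) \<in> borel_measurable borel" by simp
  qed (rule V_in)
  let ?\<nu> = "distr ?\<Gamma> (Grassmannian_borel ?m) V"
  have "rotation_invariant ?\<nu>"
    unfolding rotation_invariant_def
  proof (intro allI impI)
    fix T :: "real ^ 'n \<Rightarrow> real ^ 'n" assume T: "orthogonal_transformation T"
    let ?rot = "\<lambda>A :: real ^ 'n ^ 'd. \<chi> i. T (A $ i)"
    have rot: "orthogonal_transformation ?rot"
      by (rule orthogonal_transformation_rows[OF T])
    have [measurable]: "?rot \<in> borel_measurable borel"
      by (rule borel_measurable_linear[OF orthogonal_transformation_linear[OF rot]])
    note [measurable] = measurable_orthogonal_image_const[OF T, of ?m]
    have V_rot: "T ` V A = V (?rot A)" if A: "A \<in> good" for A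
    proof -
      have "v (?rot A) ` {..<k} = T ` v A ` {..<k}"
        by (auto simp: v_def vector_matrix_mult_orthogonal_rows[OF T] image_image)
      moreover have "dim (T ` v A ` {..<k}) = dim (v A ` {..<k})"
        using orthogonal_transformation_inj[OF T] orthogonal_transformation_linear[OF T]
        by (intro dim_image_eq) (auto intro: inj_on_subset)
      ultimately have "?rot A \<in> good" using A by (simp add: good_def)
      moreover have "T ` {x. A *v x \<in> W} = {x. ?rot A *v x \<in> W}"
      proof (intro set_eqI iffI)
        fix y assume "y \<in> {x. ?rot A *v x \<in> W}"
        moreover obtain x where "y = T x" using orthogonal_transformation_surj[OF T] by (metis surjD)
        ultimately show "y \<in> T ` {x. A *v x \<in> W}"
          by (auto simp: matrix_vector_mult_orthogonal_rows[OF T])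
      qed (auto simp: matrix_vector_mult_orthogonal_rows[OF T])
      ultimately show ?thesis using A by (simp add: V_def V0)
    qed
    have "distr ?\<nu> ?\<nu> ((`) T) = distr ?\<nu> (Grassmannian_borel ?m) ((`) T)"
      by (rule distr_cong) auto
    also have "\<dots> = distr ?\<Gamma> (Grassmannian_borel ?m) (\<lambda>A. T ` V A)"
      by (subst distr_distr) (auto simp: comp_def)
    also have "\<dots> = distr ?\<Gamma> (Grassmannian_borel ?m) (\<lambda>A. V (?rot A))"
    proof (rule distr_cong_AE)
      show "AE A in ?\<Gamma>. T ` V A = V (?rot A)"
        using AE_good by eventually_elim (rule V_rot)
    qed (auto, measurable)
    also have "\<dots> = distr (distr ?\<Gamma> borel ?rot) (Grassmannian_borel ?m) V"
      by (subst distr_distr) (auto simp: comp_def)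
    also have "\<dots> = ?\<nu>"
      by (simp add: distr_standard_gaussian_orthogonal_transformation[OF rot])
    finally show "distr ?\<nu> ?\<nu> ((`) T) = ?\<nu>" .
  qed
  then have "is_uniform_Grassmannian ?m ?\<nu>"
    by (simp add: is_uniform_Grassmannian_def \<Gamma>.prob_space_distr)
  moreover have "AE A in ?\<Gamma>. V A = {x. A *v x \<in> W}"
    using AE_good by eventually_elim (simp add: V_def V0)
  ultimately show ?thesis using that[OF V_meas] by blast
qed

text \<open>
  Existence: the preimage of an \<open>m\<close>-dimensional subspace under a square Gaussian matrix.
\<close>

lemma is_uniform_Grassmannian_uniform:
  assumes "m \<le> CARD('n)"
  shows "is_uniform_Grassmannian m (uniform_Grassmannian m :: (real ^ 'n) set measure)"
proof -
  obtain W :: "(real ^ 'n) set" where W: "subspace W" "dim W = m"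
    using choose_subspace_of_subspace[of m "UNIV :: (real ^ 'n) set"] assms by auto
  have "\<exists>\<nu>. is_uniform_Grassmannian (CARD('n) - (CARD('n) - m)) (\<nu> :: (real ^ 'n) set measure)"
    by (rule gaussian_preimage_subspace_uniform[OF W(1), of "CARD('n) - m", where 'n='n])
       (use W(2) assms in auto)
  then obtain \<nu> :: "(real ^ 'n) set measure" where \<nu>: "is_uniform_Grassmannian m \<nu>"
    using assms by auto
  show ?thesis unfolding uniform_Grassmannian_eqI[OF \<nu>] by (rule \<nu>)
qed

section \<open>Faces and tangent cones of linear images\<close>

text \<open>
  The linear subspace parallel to the affine hull. For a nonempty face \<open>G\<close> of a convex set
  it is the lineality space of the tangent cone at \<open>G\<close>.
\<close>

definition direction_space :: "'a::real_vector set \<Rightarrow> 'a set" where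
  "direction_space G = span {x - y |x y. x \<in> G \<and> y \<in> G}"

lemma subspace_direction_space [simp]: "subspace (direction_space G)"
  by (simp add: direction_space_def)

lemma direction_space_linear_image:
  assumes "linear f"
  shows "direction_space (f ` G) = f ` direction_space G"
proof -
  have "{x - y |x y. x \<in> f ` G \<and> y \<in> f ` G} = f ` {x - y |x y. x \<in> G \<and> y \<in> G}"
    by (auto simp: image_iff linear_diff[OF assms]) (metis linear_diff[OF assms])+
  then show ?thesis
    unfolding direction_space_def using linear_span_image[OF assms] by simp
qed

lemma direction_space_eq:
  assumes "z \<in> G"
  shows "direction_space G = span ((\<lambda>x. x - z) ` G)"
proof
  show "span ((\<lambda>x. x - z) ` G) \<subseteq> direction_space G"
    unfolding direction_space_def by (rule span_mono) (use assms in auto)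
  have "x - y \<in> span ((\<lambda>x. x - z) ` G)" if "x \<in> G" "y \<in> G" for x y
    using that span_diff[of "x - z" "(\<lambda>x. x - z) ` G" "y - z"] by (simp add: span_base)
  then show "direction_space G \<subseteq> span ((\<lambda>x. x - z) ` G)"
    unfolding direction_space_def by (intro span_minimal) auto
qed

lemma aff_dim_direction_space:
  fixes G :: "'a::euclidean_space set"
  assumes "G \<noteq> {}"
  shows "aff_dim G = int (dim (direction_space G))"
proof -
  obtain z where z: "z \<in> G" using assms by auto
  have "aff_dim G = int (dim ((+) (- z) ` G))"
    by (rule aff_dim_eq_dim) (simp add: hull_inc z)
  then show ?thesis
    by (simp add: direction_space_eq[OF z])
qed

lemma affine_hull_direction_space:
  fixes G :: "'a::euclidean_space set"
  assumes "z \<in> G" "v \<in> direction_space G"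
  shows "z + v \<in> affine hull G"
proof -
  have "affine hull G = (+) z ` span ((\<lambda>x. - z + x) ` G)"
    by (rule affine_hull_span_gen) (simp add: hull_inc assms(1))
  then show ?thesis
    using assms direction_space_eq[OF assms(1)] by simp
qed

text \<open>
  Since \<open>g\<close> is relatively interior, the segment from \<open>z\<close> to \<open>g\<close> can be prolonged beyond \<open>g\<close> within
  \<open>F\<close>. So \<open>g\<close> is a proper convex combination of \<open>z\<close> and a further point of \<open>F\<close>, and a proportional
  part of the displacement \<open>\<epsilon> *\<^sub>R v\<close> at \<open>z\<close> is possible at \<open>g\<close>.
\<close>

lemma tangent_cone_base_point:
  fixes P :: "'a::euclidean_space set"
  assumes "convex P" "F \<subseteq> P" "convex F" "g \<in> rel_interior F" "z \<in> F" "\<epsilon> > 0" "z + \<epsilon> *\<^sub>R v \<in> P"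
  shows "\<exists>\<epsilon>>0. g + \<epsilon> *\<^sub>R v \<in> P"
proof -
  obtain e where e: "e > 1" "(1 - e) *\<^sub>R z + e *\<^sub>R g \<in> F"
    using convex_rel_interior_iff[OF assms(3), of g] assms(4,5) by blast
  have "(1 / e) *\<^sub>R ((1 - e) *\<^sub>R z + e *\<^sub>R g) + (1 - 1 / e) *\<^sub>R (z + \<epsilon> *\<^sub>R v) \<in> P"
  proof (rule convexD[OF assms(1)])
    show "(1 - e) *\<^sub>R z + e *\<^sub>R g \<in> P" using e(2) assms(2) by blast
  qed (use e(1) assms(7) in auto)
  also have "(1 / e) *\<^sub>R ((1 - e) *\<^sub>R z + e *\<^sub>R g) + (1 - 1 / e) *\<^sub>R (z + \<epsilon> *\<^sub>R v)
      = ((1 / e) * (1 - e)) *\<^sub>R z + ((1 / e) * e) *\<^sub>R g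
        + ((1 - 1 / e) *\<^sub>R z + ((1 - 1 / e) * \<epsilon>) *\<^sub>R v)"
    by (simp only: scaleR_add_right scaleR_scaleR)
  also have "(1 / e) * (1 - e) = - (1 - 1 / e)" using e by (simp add: field_simps)
  also have "(1 / e) * e = 1" using e by simp
  also have "- (1 - 1 / e) *\<^sub>R z + 1 *\<^sub>R g + ((1 - 1 / e) *\<^sub>R z + ((1 - 1 / e) * \<epsilon>) *\<^sub>R v)
      = g + ((1 - 1 / e) * \<epsilon>) *\<^sub>R v"
    by (simp only: scaleR_minus_left scaleR_one) simp
  finally show ?thesis
    using e assms(6) by (intro exI[of _ "(1 - 1 / e) * \<epsilon>"]) auto
qed

lemma tangent_cone_at_rel_interior:
  fixes P :: "'a::euclidean_space set"
  assumes "convex P" "F \<subseteq> P" "convex F" "F \<noteq> {}"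
  obtains g where "g \<in> rel_interior F" "tangent_cone F P = {v. \<exists>\<epsilon>>0. g + \<epsilon> *\<^sub>R v \<in> P}"
proof
  show "(SOME f. f \<in> rel_interior F) \<in> rel_interior F"
    using assms rel_interior_eq_empty some_in_eq by blast
qed (simp add: tangent_cone_def)

text \<open>
  Relative interiors and the choice of a base point disappear from the tangent cone: it is the
  union of the cones of feasible directions at all points of the face.
\<close>

lemma tangent_cone_iff:
  fixes P :: "'a::euclidean_space set"
  assumes "convex P" "F \<subseteq> P" "convex F" "F \<noteq> {}"
  shows "v \<in> tangent_cone F P \<longleftrightarrow> (\<exists>z\<in>F. \<exists>\<epsilon>>0. z + \<epsilon> *\<^sub>R v \<in> P)"
proof -
  obtain g where g: "g \<in> rel_interior F" "tangent_cone F P = {v. \<exists>\<epsilon>>0. g + \<epsilon> *\<^sub>R v \<in> P}"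
    using tangent_cone_at_rel_interior[OF assms] by blast
  then show ?thesis
    using tangent_cone_base_point[OF assms(1-3) g(1)] rel_interior_subset[of F] by blast
qed

lemma zero_in_tangent_cone:
  fixes P :: "'a::euclidean_space set"
  assumes "convex P" "F \<subseteq> P" "convex F" "F \<noteq> {}"
  shows "0 \<in> tangent_cone F P"
  unfolding tangent_cone_iff[OF assms] using assms by (auto intro: exI[of _ 1])

text \<open>
  By convexity the step lengths \<open>1 / Suc n\<close> suffice, and each of them contributes a closed set.
\<close>

lemma fsigma_in_tangent_cone:
  fixes P :: "'a::euclidean_space set"
  assumes P: "convex P" "closed P" and F: "F \<subseteq> P" "convex F" "F \<noteq> {}"
  shows "fsigma_in euclidean (tangent_cone F P)"
proof -
  obtain g where g: "g \<in> rel_interior F" "tangent_cone F P = {v. \<exists>\<epsilon>>0. g + \<epsilon> *\<^sub>R v \<in> P}"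
    using tangent_cone_at_rel_interior[OF P(1) F] by blast
  define D where "D n = {v. g + (1 / real (Suc n)) *\<^sub>R v \<in> P}" for n
  have "g \<in> P" using g(1) rel_interior_subset F(1) by blast
  have "tangent_cone F P = \<Union>(range D)"
  proof (intro set_eqI iffI)
    fix v assume "v \<in> tangent_cone F P"
    then obtain \<epsilon> where \<epsilon>: "\<epsilon> > 0" "g + \<epsilon> *\<^sub>R v \<in> P" using g(2) by auto
    obtain n where n: "1 / real (Suc n) < \<epsilon>"
      using \<epsilon>(1) nat_approx_posE by blast
    define t where "t = 1 / real (Suc n) / \<epsilon>"
    have t: "0 \<le> t" "t \<le> 1" "t * \<epsilon> = 1 / real (Suc n)"
      unfolding t_def using less_imp_le[OF n] \<epsilon>(1) by (simp_all only: divide_le_eq_1_pos) auto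
    have "(1 - t) *\<^sub>R g + t *\<^sub>R (g + \<epsilon> *\<^sub>R v) \<in> P"
      using t \<epsilon>(2) \<open>g \<in> P\<close> by (intro convexD[OF P(1)]) auto
    also have "(1 - t) *\<^sub>R g + t *\<^sub>R (g + \<epsilon> *\<^sub>R v) = g + (t * \<epsilon>) *\<^sub>R v"
      by (simp add: algebra_simps)
    finally show "v \<in> \<Union>(range D)" using t(3) by (auto simp: D_def)
  next
    fix v assume "v \<in> \<Union>(range D)"
    then obtain n where "g + (1 / real (Suc n)) *\<^sub>R v \<in> P" by (auto simp: D_def)
    moreover have "1 / real (Suc n) > 0" by simp
    ultimately show "v \<in> tangent_cone F P" unfolding g(2) by blast
  qed
  moreover have "closed (D n)" for n
  proof -
    have "closed ((\<lambda>v. g + (1 / real (Suc n)) *\<^sub>R v) -` P)"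
      by (intro closed_vimage P(2) continuous_intros)
    then show ?thesis by (simp add: D_def vimage_def)
  qed
  then have "fsigma_in euclidean (\<Union>(range D))"
    by (intro fsigma_in_Union) (auto intro: closed_imp_fsigma_in)
  ultimately show ?thesis by simp
qed

lemma tangent_cone_linear_image:
  fixes f :: "'a::euclidean_space \<Rightarrow> 'b::euclidean_space"
  assumes f: "linear f" and P: "convex P" and F: "F \<subseteq> P" "convex F" "F \<noteq> {}"
  shows "tangent_cone (f ` F) (f ` P) = f ` tangent_cone F P"
proof -
  note im = tangent_cone_iff[of "f ` P" "f ` F", OF convex_linear_image[OF f P] image_mono[OF F(1)]
      convex_linear_image[OF f F(2)]]
  show ?thesis
  proof (intro set_eqI iffI)
    fix v assume "v \<in> tangent_cone (f ` F) (f ` P)"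
    then obtain z \<epsilon> p where z: "z \<in> F" "\<epsilon> > 0" "p \<in> P" "f z + \<epsilon> *\<^sub>R v = f p"
      using im F(3) by auto
    define w where "w = (1 / \<epsilon>) *\<^sub>R (p - z)"
    have "z + \<epsilon> *\<^sub>R w \<in> P" using z by (simp add: w_def)
    then have "w \<in> tangent_cone F P"
      unfolding tangent_cone_iff[OF P F] using z by blast
    moreover have "f w = v"
      using z(2) arg_cong[OF z(4), of "\<lambda>y. (1 / \<epsilon>) *\<^sub>R (y - f z)"]
      by (simp add: w_def linear_scale[OF f] linear_diff[OF f])
    ultimately show "v \<in> f ` tangent_cone F P" by blast
  next
    fix v assume "v \<in> f ` tangent_cone F P"
    then obtain z \<epsilon> w where z: "z \<in> F" "\<epsilon> > 0" "z + \<epsilon> *\<^sub>R w \<in> P" "v = f w"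
      using tangent_cone_iff[OF P F] by auto
    then have "f z + \<epsilon> *\<^sub>R v = f (z + \<epsilon> *\<^sub>R w)"
      by (simp add: linear_add[OF f] linear_scale[OF f])
    then show "v \<in> tangent_cone (f ` F) (f ` P)"
      using z im F(3) by blast
  qed
qed

text \<open>
  The condition on the tangent cone under which the image of a face under a linear map is a face
  of the image and no other point of \<open>P\<close> is mapped into it. If \<open>f\<close> is injective on the direction
  space, it says that the kernel of \<open>f\<close> meets the tangent cone only in 0.
\<close>

definition persistent_face :: "('a::euclidean_space \<Rightarrow> 'b::euclidean_space) \<Rightarrow> 'a set \<Rightarrow> 'a set \<Rightarrow> bool" where
  "persistent_face f P G \<longleftrightarrow> (\<forall>v\<in>tangent_cone G P. f v = 0 \<longrightarrow> v \<in> direction_space G)"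

text \<open>
  The difference \<open>p - z\<close> is a tangent direction in the kernel, hence parallel to \<open>G\<close>, and a face
  contains every point of \<open>P\<close> that lies in its affine hull.
\<close>

lemma persistent_face_vimage:
  fixes f :: "'a::euclidean_space \<Rightarrow> 'b::euclidean_space"
  assumes f: "linear f" and P: "convex P" and G: "G face_of P"
    and pers: "persistent_face f P G" and z: "z \<in> G" and p: "p \<in> P" "f p = f z"
  shows "p \<in> G"
proof -
  have G': "G \<subseteq> P" "convex G" "G \<noteq> {}"
    using G z by (auto dest: face_of_imp_subset face_of_imp_convex)
  have "z + 1 *\<^sub>R (p - z) \<in> P" using p by simp
  then have "p - z \<in> tangent_cone G P"
    unfolding tangent_cone_iff[OF P G'] using z zero_less_one by blast
  moreover have "f (p - z) = 0" using p by (simp add: linear_diff[OF f])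
  ultimately have "p - z \<in> direction_space G"
    using pers by (auto simp: persistent_face_def)
  then have "p \<in> affine hull G"
    using affine_hull_direction_space[OF z] by fastforce
  then show ?thesis
    using face_of_imp_eq_affine_Int[OF P G] p(1) by auto
qed

lemma persistent_face_image:
  fixes f :: "'a::euclidean_space \<Rightarrow> 'b::euclidean_space"
  assumes f: "linear f" and P: "convex P" and G: "G face_of P" and pers: "persistent_face f P G"
  shows "f ` G face_of f ` P"
  unfolding face_of_def
proof (intro conjI ballI impI)
  show "f ` G \<subseteq> f ` P" using face_of_imp_subset[OF G] by blast
  show "convex (f ` G)" using face_of_imp_convex[OF G] by (rule convex_linear_image[OF f])
  fix a b y assume "a \<in> f ` P" "b \<in> f ` P" "y \<in> f ` G" and y: "y \<in> open_segment a b"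
  then obtain x x' z where x: "x \<in> P" "a = f x" "x' \<in> P" "b = f x'" "z \<in> G" "y = f z" by auto
  obtain t where t: "0 < t" "t < 1" "f z = (1 - t) *\<^sub>R f x + t *\<^sub>R f x'" "x \<noteq> x'"
    using y x by (auto simp: in_segment)
  define z' where "z' = (1 - t) *\<^sub>R x + t *\<^sub>R x'"
  have "z' \<in> P" unfolding z'_def using x t by (intro convexD[OF P]) auto
  moreover have "f z' = f z"
    by (simp add: z'_def t(3) linear_add[OF f] linear_scale[OF f])
  ultimately have "z' \<in> G"
    using persistent_face_vimage[OF f P G pers x(5)] by blast
  moreover have "z' \<in> open_segment x x'"
    using t by (auto simp: in_segment z'_def)
  ultimately have "x \<in> G \<and> x' \<in> G"
    using G x by (auto simp: face_of_def)
  then show "a \<in> f ` G" "b \<in> f ` G" using x by auto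
qed

text \<open>
  Every face \<open>F\<close> of the image comes from the face \<open>P \<inter> f -` F\<close> of \<open>P\<close>, and this face is
  persistent because a tangent direction in the kernel does not leave it. No general position is
  assumed, so the faces of \<open>A P\<close> are described for every realisation of the matrix, and the sum over
  them becomes a sum over the fixed set of faces of \<open>P\<close>, finite if \<open>P\<close> is polyhedral, with measurable summands. Faces \<open>G\<close>
  of dimension greater than \<open>j\<close> may contribute for singular matrices.
\<close>

lemma faces_linear_image_bij:
  fixes f :: "'a::euclidean_space \<Rightarrow> 'b::euclidean_space"
  assumes f: "linear f" and P: "convex P"
  shows "bij_betw ((`) f)
    {G. G face_of P \<and> G \<noteq> {} \<and> persistent_face f P G \<and> dim (f ` direction_space G) = j}
    (faces_of_dim j (f ` P))"
  unfolding bij_betw_def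
proof
  let ?\<G> = "{G. G face_of P \<and> G \<noteq> {} \<and> persistent_face f P G \<and> dim (f ` direction_space G) = j}"
  show "inj_on ((`) f) ?\<G>"
  proof (rule inj_onI)
    have sub: "G \<subseteq> G'" if G: "G \<in> ?\<G>" "G' \<in> ?\<G>" "f ` G = f ` G'" for G G'
    proof
      fix x assume "x \<in> G"
      moreover from this obtain z where "z \<in> G'" "f x = f z" using G(3) by auto
      ultimately show "x \<in> G'"
        using persistent_face_vimage[OF f P, of G' z x] G face_of_imp_subset[of G P] by auto
    qed
    fix G G' assume "G \<in> ?\<G>" "G' \<in> ?\<G>" "f ` G = f ` G'"
    then show "G = G'" using sub[of G G'] sub[of G' G] by simp
  qed
  have aff: "aff_dim (f ` G) = int (dim (f ` direction_space G))" if "G \<noteq> {}" for G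
    using that by (simp add: aff_dim_direction_space direction_space_linear_image[OF f])
  show "(`) f ` ?\<G> = faces_of_dim j (f ` P)"
  proof (intro set_eqI iffI)
    fix F assume "F \<in> (`) f ` ?\<G>"
    then obtain G where "F = f ` G" "G \<in> ?\<G>" by blast
    then show "F \<in> faces_of_dim j (f ` P)"
      using persistent_face_image[OF f P, of G] aff[of G] by (simp add: faces_of_dim_def)
  next
    fix F assume "F \<in> faces_of_dim j (f ` P)"
    then have F: "F face_of f ` P" "aff_dim F = int j" by (auto simp: faces_of_dim_def)
    define G where "G = P \<inter> f -` F"
    have FG: "F = f ` G" using face_of_imp_subset[OF F(1)] by (auto simp: G_def)
    have "F \<noteq> {}" using F(2) by auto
    then have "G \<noteq> {}" using FG by auto
    have "G face_of P"
      unfolding face_of_def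
    proof (intro conjI ballI impI)
      show "G \<subseteq> P" by (simp add: G_def)
      show "convex G"
        unfolding G_def using face_of_imp_convex[OF F(1)]
        by (intro convex_Int P convex_linear_vimage f)
      fix a b x assume ab: "a \<in> P" "b \<in> P" "x \<in> G" "x \<in> open_segment a b"
      then obtain t where t: "0 < t" "t < 1" "x = (1 - t) *\<^sub>R a + t *\<^sub>R b"
        by (auto simp: in_segment)
      have fx: "f x = (1 - t) *\<^sub>R f a + t *\<^sub>R f b" "f x \<in> F"
        using ab(3) by (simp_all add: G_def t(3) linear_add[OF f] linear_scale[OF f])
      have "f a \<in> F \<and> f b \<in> F"
      proof (cases "f a = f b")
        case True
        then have "f x = f a" using fx(1) by (simp add: algebra_simps)
        then show ?thesis using True fx(2) by simp
      next
        case False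
        then have "f x \<in> open_segment (f a) (f b)"
          using t fx(1) by (auto simp: in_segment)
        then show ?thesis using F(1) fx(2) ab by (auto simp: face_of_def)
      qed
      then show "a \<in> G" "b \<in> G" using ab by (auto simp: G_def)
    qed
    moreover have "persistent_face f P G"
      unfolding persistent_face_def
    proof (intro ballI impI)
      fix v assume v: "v \<in> tangent_cone G P" "f v = 0"
      have "G \<subseteq> P" "convex G"
        using \<open>G face_of P\<close> P by (auto dest: face_of_imp_subset face_of_imp_convex)
      then obtain z \<epsilon> where z: "z \<in> G" "\<epsilon> > 0" "z + \<epsilon> *\<^sub>R v \<in> P"
        using v(1) tangent_cone_iff[OF P _ _ \<open>G \<noteq> {}\<close>] by blast
      have "z + \<epsilon> *\<^sub>R v \<in> G"
        using z v(2) by (simp add: G_def linear_add[OF f] linear_scale[OF f])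
      then have "(z + \<epsilon> *\<^sub>R v) - z \<in> direction_space G"
        unfolding direction_space_def using z(1) by (intro span_base) blast
      then have "(1 / \<epsilon>) *\<^sub>R ((z + \<epsilon> *\<^sub>R v) - z) \<in> direction_space G"
        by (intro subspace_scale) auto
      then show "v \<in> direction_space G" using z(2) by simp
    qed
    moreover have "dim (f ` direction_space G) = j"
      using aff[OF \<open>G \<noteq> {}\<close>] F(2) FG by simp
    ultimately show "F \<in> (`) f ` ?\<G>" using FG \<open>G \<noteq> {}\<close> by blast
  qed
qed

section \<open>Grassmann angles of Gaussian images of cones\<close>

lemma borel_measurable_matrix_vector_mult [measurable]:
  "(\<lambda>A :: real ^ 'n ^ 'd. A *v x) \<in> borel_measurable borel"
  using bilinear_matrix_vector_mult[where 'n='n and 'd='d]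
  by (intro borel_measurable_linear) (simp add: bilinear_def)

lemma continuous_on_matrix_vector_mult:
  "continuous_on X ((*v) (A :: real ^ 'n ^ 'd))"
  by (rule linear_continuous_on) (simp add: linear_conv_bounded_linear[symmetric])

lemma sets_kernel_hit:
  fixes C :: "(real ^ 'n) set"
  assumes "fsigma_in euclidean C"
  shows "{A :: real ^ 'n ^ 'd. \<exists>x\<in>C. A *v x = 0} \<in> sets borel"
  using sets_exists_zero_fsigma[OF assms, of "(*v)" "borel :: (real ^ 'n ^ 'd) measure"]
  by (simp add: continuous_on_matrix_vector_mult borel_measurable_matrix_vector_mult)

lemma sets_Grassmannian_hit:
  fixes C :: "'a::euclidean_space set"
  assumes "fsigma_in euclidean C"
  shows "{W \<in> Grassmannian m. \<exists>x\<in>C. x \<in> W} \<in> sets (Grassmannian_borel m)"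
proof -
  have "{W \<in> space (Grassmannian_borel m). \<exists>x\<in>C. closest_point W x - x = 0} \<in> sets (Grassmannian_borel m)"
  proof (rule sets_exists_zero_fsigma[OF assms])
    fix W :: "'a set" assume "W \<in> space (Grassmannian_borel m)"
    then have "linear (closest_point W)"
      by (simp add: Grassmannian_def linear_closest_point_subspace)
    then have "continuous_on C (closest_point W)"
      by (intro linear_continuous_on) (simp add: linear_conv_bounded_linear)
    then show "continuous_on C (\<lambda>x. closest_point W x - x)" by (intro continuous_intros)
  qed measurable
  also have "{W \<in> space (Grassmannian_borel m). \<exists>x\<in>C. closest_point W x - x = 0}
      = {W \<in> Grassmannian m. \<exists>x\<in>C. x \<in> W}"
    by (auto simp: Grassmannian_def closest_point_subspace_refl)
  finally show ?thesis .
qed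

text \<open>
  Membership \<open>A *v x \<in> W\<close> is a zero of \<open>closest_point W (A *v x) - A *v x\<close>. The condition
  \<open>A *v x \<noteq> 0\<close> depends on \<open>A\<close> as well and cannot be put into the set over which \<open>x\<close> ranges. It is
  written as the union over \<open>n\<close> of the closed conditions \<open>1 / Suc n \<le> norm (A *v x)\<close>, each of which
  is the vanishing of a nonnegative continuous penalty.
\<close>

lemma sets_image_hit_nonzero:
  fixes C :: "(real ^ 'n) set"
  assumes C: "fsigma_in euclidean C"
  shows "{(A :: real ^ 'n ^ 'd, W). W \<in> Grassmannian m \<and> (\<exists>x\<in>C. A *v x \<noteq> 0 \<and> A *v x \<in> W)}
    \<in> sets (borel \<Otimes>\<^sub>M Grassmannian_borel m)"
proof -
  let ?S = "borel \<Otimes>\<^sub>M Grassmannian_borel m :: ((real ^ 'n ^ 'd) \<times> (real ^ 'd) set) measure"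
  define h where "h n s x = norm (closest_point (snd s) (fst s *v x) - fst s *v x)
      + max 0 (1 / real (Suc n) - norm (fst s *v x))"
    for n and s :: "(real ^ 'n ^ 'd) \<times> (real ^ 'd) set" and x
  have h_sets: "{s \<in> space ?S. \<exists>x\<in>C. h n s x = 0} \<in> sets ?S" for n
  proof (rule sets_exists_zero_fsigma[OF C])
    fix x
    have [measurable]: "(\<lambda>s. closest_point (snd s) (fst s *v x)) \<in> borel_measurable ?S"
      by (rule measurable_closest_point2[where m = m]) measurable
    show "(\<lambda>s. h n s x) \<in> borel_measurable ?S" unfolding h_def by measurable
  next
    fix s assume "s \<in> space ?S"
    then have "linear (closest_point (snd s))"
      by (auto simp: space_pair_measure Grassmannian_def linear_closest_point_subspace)
    then have "continuous_on UNIV (closest_point (snd s))"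
      by (intro linear_continuous_on) (simp add: linear_conv_bounded_linear)
    from continuous_on_compose2[OF this continuous_on_matrix_vector_mult[of C "fst s"]]
    have "continuous_on C (\<lambda>x. closest_point (snd s) (fst s *v x))" by simp
    then show "continuous_on C (h n s)"
      unfolding h_def by (intro continuous_intros continuous_on_max continuous_on_matrix_vector_mult)
  qed
  have h0: "h n s x = 0 \<longleftrightarrow> fst s *v x \<in> snd s \<and> 1 / real (Suc n) \<le> norm (fst s *v x)"
    if "s \<in> space ?S" for s n x
  proof -
    have "subspace (snd s)" using that by (auto simp: space_pair_measure Grassmannian_def)
    then have "fst s *v x \<in> snd s \<longleftrightarrow> norm (closest_point (snd s) (fst s *v x) - fst s *v x) = 0"
      by (simp add: closest_point_subspace_refl)
    then show ?thesis unfolding h_def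
      by (smt (verit, best) max_def norm_ge_zero)
  qed
  have pos: "y \<noteq> 0 \<longleftrightarrow> (\<exists>n. 1 / real (Suc n) \<le> norm y)" for y :: "real ^ 'd"
  proof
    assume "y \<noteq> 0"
    then obtain n where "1 / real (Suc n) < norm y"
      using nat_approx_posE[of "norm y"] by auto
    then show "\<exists>n. 1 / real (Suc n) \<le> norm y" by (auto intro: less_imp_le)
  next
    assume "\<exists>n. 1 / real (Suc n) \<le> norm y"
    then obtain n where n: "1 / real (Suc n) \<le> norm y" ..
    have "0 < 1 / real (Suc n)" by simp
    with n have "0 < norm y" by linarith
    then show "y \<noteq> 0" by auto
  qed
  have "{(A :: real ^ 'n ^ 'd, W). W \<in> Grassmannian m \<and> (\<exists>x\<in>C. A *v x \<noteq> 0 \<and> A *v x \<in> W)}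
      = {s \<in> space ?S. \<exists>n. \<exists>x\<in>C. h n s x = 0}"
  proof (intro set_eqI iffI)
    fix s assume "s \<in> {(A :: real ^ 'n ^ 'd, W). W \<in> Grassmannian m \<and> (\<exists>x\<in>C. A *v x \<noteq> 0 \<and> A *v x \<in> W)}"
    then obtain x where "s \<in> space ?S" "x \<in> C" "fst s *v x \<noteq> 0" "fst s *v x \<in> snd s"
      by (auto simp: space_pair_measure)
    then show "s \<in> {s \<in> space ?S. \<exists>n. \<exists>x\<in>C. h n s x = 0}"
      using h0[of s] pos by blast
  next
    fix s assume "s \<in> {s \<in> space ?S. \<exists>n. \<exists>x\<in>C. h n s x = 0}"
    then obtain x where "s \<in> space ?S" "x \<in> C" "fst s *v x \<noteq> 0" "fst s *v x \<in> snd s"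
      using h0[of s] pos by blast
    then show "s \<in> {(A :: real ^ 'n ^ 'd, W). W \<in> Grassmannian m \<and> (\<exists>x\<in>C. A *v x \<noteq> 0 \<and> A *v x \<in> W)}"
      by (auto simp: space_pair_measure)
  qed
  also have "\<dots> = (\<Union>n. {s \<in> space ?S. \<exists>x\<in>C. h n s x = 0})" by blast
  also have "\<dots> \<in> sets ?S" using h_sets by blast
  finally show ?thesis .
qed

lemma sets_uniform_Grassmannian:
  assumes "m \<le> CARD('n)"
  shows "sets (uniform_Grassmannian m :: (real ^ 'n) set measure) = sets (Grassmannian_borel m)"
    and "space (uniform_Grassmannian m :: (real ^ 'n) set measure) = Grassmannian m"
    and "prob_space (uniform_Grassmannian m :: (real ^ 'n) set measure)"
  using is_uniform_Grassmannian_uniform[OF assms] by (auto simp: is_uniform_Grassmannian_def)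

lemma Grassmann_angle_eq:
  fixes C :: "(real ^ 'n) set"
  assumes "0 \<in> C"
  shows "Grassmann_angle (int k) C
    = measure (uniform_Grassmannian (CARD('n) - k)) {W \<in> Grassmannian (CARD('n) - k). \<exists>x\<in>C - {0}. x \<in> W}"
proof -
  have "{W \<in> Grassmannian (CARD('n) - k). W \<inter> C \<noteq> {0}}
      = {W \<in> Grassmannian (CARD('n) - k). \<exists>x\<in>C - {0}. x \<in> W}"
    using assms by (auto simp: Grassmannian_def subspace_0)
  then show ?thesis by (simp add: Grassmann_angle_def)
qed

text \<open>
  The preimage of \<open>W\<close> is a uniformly distributed subspace of codimension \<open>k\<close>, and \<open>A\<close> maps a
  nonzero point of \<open>C\<close> into \<open>W\<close> exactly if the preimage meets \<open>C\<close> outside 0. The case \<open>W = {0}\<close> gives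
  the probability that the kernel of \<open>A\<close> meets \<open>C\<close> nontrivially.
\<close>

lemma gaussian_preimage_hit:
  fixes C :: "(real ^ 'n) set" and W :: "(real ^ 'd) set"
  assumes C: "0 \<in> C" "fsigma_in euclidean C"
    and W: "subspace W" "dim W + k = CARD('d)" "k \<le> CARD('n)"
  shows "measure (standard_gaussian :: (real ^ 'n ^ 'd) measure) {A. \<exists>x\<in>C - {0}. A *v x \<in> W}
    = Grassmann_angle (int k) C"
proof -
  let ?\<Gamma> = "standard_gaussian :: (real ^ 'n ^ 'd) measure" and ?m = "CARD('n) - k"
  interpret \<Gamma>: prob_space ?\<Gamma> by (rule prob_space_standard_gaussian)
  let ?H = "{V \<in> Grassmannian ?m. \<exists>x\<in>C - {0}. x \<in> V}"
  have C0: "fsigma_in euclidean (C - {0})"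
    using C(2) by (rule fsigma_in_closed_diff) simp
  have [measurable]: "?H \<in> sets (Grassmannian_borel ?m)"
    by (rule sets_Grassmannian_hit[OF C0])
  have meas: "{A :: real ^ 'n ^ 'd. \<exists>x\<in>C - {0}. A *v x \<in> W} \<in> sets borel"
  proof -
    have "{A \<in> space borel. \<exists>x\<in>C - {0}. closest_point W (A *v x) - A *v x = 0} \<in> sets borel"
    proof (rule sets_exists_zero_fsigma[OF C0])
      have cp: "continuous_on UNIV (closest_point W)"
        using linear_closest_point_subspace[OF W(1)]
        by (intro linear_continuous_on) (simp add: linear_conv_bounded_linear)
      then have [measurable]: "closest_point W \<in> borel_measurable borel"
        by (rule borel_measurable_continuous_onI)
      show "(\<lambda>A :: real ^ 'n ^ 'd. closest_point W (A *v x) - A *v x) \<in> borel_measurable borel" for x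
        by measurable
      fix A :: "real ^ 'n ^ 'd"
      have "continuous_on (C - {0}) (\<lambda>x. closest_point W (A *v x))"
        by (rule continuous_on_compose2[OF cp continuous_on_matrix_vector_mult]) simp
      then show "continuous_on (C - {0}) (\<lambda>x. closest_point W (A *v x) - A *v x)"
        by (intro continuous_intros continuous_on_matrix_vector_mult)
    qed
    then show ?thesis by (simp add: closest_point_subspace_refl[OF W(1)])
  qed
  have "\<exists>V :: real ^ 'n ^ 'd \<Rightarrow> (real ^ 'n) set. V \<in> borel \<rightarrow>\<^sub>M Grassmannian_borel ?m \<and>
      (AE A in ?\<Gamma>. V A = {x. A *v x \<in> W}) \<and>
      is_uniform_Grassmannian ?m (distr ?\<Gamma> (Grassmannian_borel ?m) V)"
    by (rule gaussian_preimage_subspace_uniform[OF W]) blast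
  then obtain V :: "real ^ 'n ^ 'd \<Rightarrow> (real ^ 'n) set"
    where V[measurable]: "V \<in> borel \<rightarrow>\<^sub>M Grassmannian_borel ?m"
      and AE_V: "AE A in ?\<Gamma>. V A = {x. A *v x \<in> W}"
      and unif: "is_uniform_Grassmannian ?m (distr ?\<Gamma> (Grassmannian_borel ?m) V)"
    by blast
  have "Grassmann_angle (int k) C = measure (distr ?\<Gamma> (Grassmannian_borel ?m) V) ?H"
    by (simp only: Grassmann_angle_eq[OF C(1)] uniform_Grassmannian_eqI[OF unif])
  also have "\<dots> = measure ?\<Gamma> (V -` ?H \<inter> space ?\<Gamma>)"
    by (rule measure_distr) measurable
  also have "\<dots> = measure ?\<Gamma> {A. \<exists>x\<in>C - {0}. A *v x \<in> W}"
  proof (rule \<Gamma>.finite_measure_eq_AE)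
    show "AE A in ?\<Gamma>. A \<in> V -` ?H \<inter> space ?\<Gamma> \<longleftrightarrow> A \<in> {A. \<exists>x\<in>C - {0}. A *v x \<in> W}"
      using AE_V
    proof eventually_elim
      case (elim A)
      have "V A \<in> Grassmannian ?m" using measurable_space[OF V, of A] by simp
      then show ?case unfolding elim by (auto simp: elim)
    qed
    show "V -` ?H \<inter> space ?\<Gamma> \<in> sets ?\<Gamma>" by measurable
    show "{A. \<exists>x\<in>C - {0}. A *v x \<in> W} \<in> sets ?\<Gamma>" using meas by simp
  qed
  finally show ?thesis by simp
qed

lemma image_hit_eq:
  "{W \<in> Grassmannian m. \<exists>y\<in>(*v) A ` C - {0}. y \<in> W}
    = {W. W \<in> Grassmannian m \<and> (\<exists>x\<in>C. A *v x \<noteq> 0 \<and> A *v x \<in> W)}"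
  by auto

text \<open>
  The angle is the measure of a section of a measurable subset of the product space.
\<close>

lemma borel_measurable_Grassmann_angle_image:
  fixes C :: "(real ^ 'n) set"
  assumes C: "0 \<in> C" "fsigma_in euclidean C"
  shows "(\<lambda>A :: real ^ 'n ^ 'd. Grassmann_angle (int k) ((*v) A ` C)) \<in> borel_measurable borel"
proof -
  let ?m = "CARD('d) - k"
  let ?U = "uniform_Grassmannian ?m :: (real ^ 'd) set measure"
  interpret U: prob_space ?U by (rule sets_uniform_Grassmannian) simp
  let ?Q = "{(A :: real ^ 'n ^ 'd, W). W \<in> Grassmannian ?m \<and> (\<exists>x\<in>C. A *v x \<noteq> 0 \<and> A *v x \<in> W)}"
  have "sets (borel \<Otimes>\<^sub>M ?U) = sets ((borel :: (real ^ 'n ^ 'd) measure) \<Otimes>\<^sub>M Grassmannian_borel ?m)"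
    by (intro sets_pair_measure_cong) (simp_all add: sets_uniform_Grassmannian)
  then have "?Q \<in> sets (borel \<Otimes>\<^sub>M ?U)"
    using sets_image_hit_nonzero[OF C(2)] by simp
  then have [measurable]: "(\<lambda>A. emeasure ?U (Pair A -` ?Q)) \<in> borel_measurable borel"
    by (rule U.measurable_emeasure_Pair)
  have eq: "Grassmann_angle (int k) ((*v) A ` C) = enn2real (emeasure ?U (Pair A -` ?Q))"
    for A :: "real ^ 'n ^ 'd"
  proof -
    have "0 \<in> (*v) A ` C" using C(1) by (force simp: image_iff)
    then show ?thesis
      unfolding Grassmann_angle_eq[OF \<open>0 \<in> (*v) A ` C\<close>] image_hit_eq measure_def
      by (simp add: vimage_def)
  qed
  show ?thesis unfolding eq by measurable
qed

lemma Grassmann_angle_bounds: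
  fixes C :: "(real ^ 'n) set"
  assumes "-1 \<le> k"
  shows "0 \<le> Grassmann_angle k C" "Grassmann_angle k C \<le> 1"
proof -
  interpret U: prob_space "uniform_Grassmannian (CARD('n) - nat k) :: (real ^ 'n) set measure"
    by (rule sets_uniform_Grassmannian) simp
  show "0 \<le> Grassmann_angle k C" "Grassmann_angle k C \<le> 1"
    by (simp_all add: Grassmann_angle_def U.prob_le_1)
qed

text \<open>
  This is the contribution of a single face, with \<open>C\<close> its tangent cone. Let \<open>N\<close> be the event that
  the kernel of \<open>A\<close> meets \<open>C\<close> outside 0, and let \<open>Q\<close> be the event that the preimage under \<open>A\<close> of an
  independent uniform subspace \<open>W\<close> does so. Off \<open>N\<close>, a section of \<open>Q\<close> is the event that \<open>W\<close> meets the image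
  of \<open>C\<close> nontrivially. On \<open>N\<close>, every \<open>W\<close> belongs to the section, since the preimage contains the
  kernel. So the integrand is the probability of the section of \<open>Q\<close> minus the indicator of \<open>N\<close>. Integrating over
  \<open>A\<close> first, for fixed \<open>W\<close>, shows that \<open>Q\<close> has probability \<open>Grassmann_angle k C\<close>.
\<close>

lemma integral_Grassmann_angle_image:
  fixes C :: "(real ^ 'n) set" and k :: int
  assumes C: "0 \<in> C" "fsigma_in euclidean C" and k: "-1 \<le> k" "k \<le> int CARD('d)"
    and dn: "CARD('d) \<le> CARD('n)"
  shows "(\<integral>A. (if \<exists>x\<in>C - {0}. A *v x = 0 then 0 else Grassmann_angle k ((*v) A ` C))
      \<partial>(standard_gaussian :: (real ^ 'n ^ 'd) measure))
    = Grassmann_angle k C - Grassmann_angle (int CARD('d)) C"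
proof -
  let ?\<Gamma> = "standard_gaussian :: (real ^ 'n ^ 'd) measure"
  interpret \<Gamma>: prob_space ?\<Gamma> by (rule prob_space_standard_gaussian)
  define N where "N = {A :: real ^ 'n ^ 'd. \<exists>x\<in>C - {0}. A *v x = 0}"
  have C0: "fsigma_in euclidean (C - {0})"
    using C(2) by (rule fsigma_in_closed_diff) simp
  have N [measurable]: "N \<in> sets borel"
    unfolding N_def by (rule sets_kernel_hit[OF C0])
  have N_prob: "measure ?\<Gamma> N = Grassmann_angle (int CARD('d)) C"
    using gaussian_preimage_hit[OF C, of "{0} :: (real ^ 'd) set" "CARD('d)"] dn by (simp add: N_def)
  show ?thesis
  proof (cases "k = -1")
    case True
    have "(\<integral>A. (if \<exists>x\<in>C - {0}. A *v x = 0 then 0 else Grassmann_angle k ((*v) A ` C)) \<partial>?\<Gamma>)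
        = (\<integral>A. 1 - indicator N A \<partial>?\<Gamma>)"
      by (rule Bochner_Integration.integral_cong) (auto simp: N_def Grassmann_angle_def True)
    also have "\<dots> = 1 - measure ?\<Gamma> N"
      by (subst Bochner_Integration.integral_diff) (auto simp: \<Gamma>.prob_space[simplified] \<Gamma>.emeasure_eq_measure)
    finally show ?thesis by (simp add: N_prob True) (simp add: Grassmann_angle_def)
  next
    case False
    define l where "l = nat k"
    have l: "k = int l" "l \<le> CARD('d)" using k False by (auto simp: l_def)
    \<comment> \<open>The angle with index -1 was the constant 1; from here on the index is a natural number.\<close>
    let ?m = "CARD('d) - l"
    let ?U = "uniform_Grassmannian ?m :: (real ^ 'd) set measure"
    interpret U: prob_space ?U by (rule sets_uniform_Grassmannian) simp
    interpret pair_prob_space ?\<Gamma> ?U ..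
    note U = sets_uniform_Grassmannian(1,2)[of ?m, where 'n = 'd, simplified]
    define Q where "Q = {(A :: real ^ 'n ^ 'd, W). W \<in> Grassmannian ?m \<and> (\<exists>x\<in>C - {0}. A *v x \<in> W)}"
    have sets_eq: "sets (?\<Gamma> \<Otimes>\<^sub>M ?U) = sets (borel \<Otimes>\<^sub>M Grassmannian_borel ?m)"
      by (intro sets_pair_measure_cong) (simp_all add: U)
    have Q_eq: "Q = {(A :: real ^ 'n ^ 'd, W). W \<in> Grassmannian ?m
          \<and> (\<exists>x\<in>C. A *v x \<noteq> 0 \<and> A *v x \<in> W)} \<union> N \<times> Grassmannian ?m" (is "_ = ?Q1 \<union> _")
      by (force simp: Q_def N_def Grassmannian_def subspace_0)
    have Q_sets: "Q \<in> sets (?\<Gamma> \<Otimes>\<^sub>M ?U)"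
    proof -
      have "Grassmannian ?m \<in> sets (Grassmannian_borel ?m :: (real ^ 'd) set measure)"
        using sets.top[of "Grassmannian_borel ?m"] by simp
      then show ?thesis
        unfolding sets_eq Q_eq
        by (intro sets.Un sets_image_hit_nonzero[OF C(2)] pair_measureI N)
    qed
    have indQ: "(\<lambda>(A, W). indicator Q (A, W) :: ennreal) \<in> borel_measurable (?\<Gamma> \<Otimes>\<^sub>M ?U)"
      using Q_sets by simp
    have point: "ennreal (if A \<in> N then 0 else Grassmann_angle k ((*v) A ` C)) + indicator N A
        = (\<integral>\<^sup>+W. indicator Q (A, W) \<partial>?U)" for A
    proof (cases "A \<in> N")
      case True
      then have "(\<integral>\<^sup>+W. indicator Q (A, W) \<partial>?U) = (\<integral>\<^sup>+W. 1 \<partial>?U)"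
        by (intro nn_integral_cong) (auto simp: U Q_eq)
      then show ?thesis using True U.emeasure_space_1 by simp
    next
      case False
      have 0: "0 \<in> (*v) A ` C" using C(1) by (force simp: image_iff)
      have "(\<integral>\<^sup>+W. indicator Q (A, W) \<partial>?U) = (\<integral>\<^sup>+W. indicator (Pair A -` Q) W \<partial>?U)"
        by (simp add: indicator_def)
      also have "\<dots> = emeasure ?U (Pair A -` Q)"
        using sets_Pair1[OF Q_sets] by (rule nn_integral_indicator)
      also have "Pair A -` Q = {W. W \<in> Grassmannian ?m \<and> (\<exists>x\<in>C. A *v x \<noteq> 0 \<and> A *v x \<in> W)}"
        using False by (auto simp: Q_eq)
      also have "emeasure ?U \<dots> = ennreal (Grassmann_angle k ((*v) A ` C))"
        unfolding l(1) Grassmann_angle_eq[OF 0] image_hit_eq by (rule U.emeasure_eq_measure)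
      finally show ?thesis using False by simp
    qed
    define \<phi> where "\<phi> A = (if A \<in> N then 0 else Grassmann_angle k ((*v) A ` C))" for A :: "real ^ 'n ^ 'd"
    have [measurable]: "\<phi> \<in> borel_measurable borel"
      using borel_measurable_Grassmann_angle_image[OF C, of l, where 'd = 'd]
      unfolding \<phi>_def l(1) by measurable
    have \<phi>_bounds: "0 \<le> \<phi> A" "\<phi> A \<le> 1" for A
      using Grassmann_angle_bounds[OF k(1)] by (auto simp: \<phi>_def)
    have slice: "(\<integral>\<^sup>+A. indicator Q (A, W) \<partial>?\<Gamma>) = ennreal (Grassmann_angle k C)"
      if W: "W \<in> Grassmannian ?m" for W
    proof -
      have "(\<integral>\<^sup>+A. indicator Q (A, W) \<partial>?\<Gamma>) = (\<integral>\<^sup>+A. indicator ((\<lambda>A. (A, W)) -` Q) A \<partial>?\<Gamma>)"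
        by (simp add: indicator_def)
      also have "\<dots> = emeasure ?\<Gamma> ((\<lambda>A. (A, W)) -` Q)"
        using sets_Pair2[OF Q_sets] by (rule nn_integral_indicator)
      also have "(\<lambda>A. (A, W)) -` Q = {A. \<exists>x\<in>C - {0}. A *v x \<in> W}"
        using W by (auto simp: Q_def)
      also have "emeasure ?\<Gamma> \<dots> = ennreal (Grassmann_angle k C)"
        using gaussian_preimage_hit[OF C, of W l] W l dn
        by (simp add: \<Gamma>.emeasure_eq_measure Grassmannian_def)
      finally show ?thesis .
    qed
    have "(\<integral>\<^sup>+A. ennreal (\<phi> A) \<partial>?\<Gamma>) + emeasure ?\<Gamma> N = (\<integral>\<^sup>+A. ennreal (\<phi> A) + indicator N A \<partial>?\<Gamma>)"
      by (subst nn_integral_add) auto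
    also have "\<dots> = (\<integral>\<^sup>+A. \<integral>\<^sup>+W. indicator Q (A, W) \<partial>?U \<partial>?\<Gamma>)"
      unfolding \<phi>_def point ..
    also have "\<dots> = (\<integral>\<^sup>+W. \<integral>\<^sup>+A. indicator Q (A, W) \<partial>?\<Gamma> \<partial>?U)"
      by (rule Fubini'[symmetric]) (rule indQ)
    also have "\<dots> = (\<integral>\<^sup>+W. ennreal (Grassmann_angle k C) \<partial>?U)"
      by (rule nn_integral_cong) (simp add: U slice)
    also have "\<dots> = ennreal (Grassmann_angle k C)"
      using U.emeasure_space_1 by simp
    finally have sum: "(\<integral>\<^sup>+A. ennreal (\<phi> A) \<partial>?\<Gamma>) + emeasure ?\<Gamma> N = ennreal (Grassmann_angle k C)" .
    have "integrable ?\<Gamma> \<phi>"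
      by (rule \<Gamma>.integrable_const_bound[where B = 1]) (use \<phi>_bounds in auto)
    then have "(\<integral>\<^sup>+A. ennreal (\<phi> A) \<partial>?\<Gamma>) = ennreal (\<integral>A. \<phi> A \<partial>?\<Gamma>)"
      using \<phi>_bounds by (intro nn_integral_eq_integral) auto
    then have "ennreal ((\<integral>A. \<phi> A \<partial>?\<Gamma>) + measure ?\<Gamma> N) = ennreal (Grassmann_angle k C)"
      using sum \<phi>_bounds by (simp add: \<Gamma>.emeasure_eq_measure ennreal_plus[symmetric] integral_nonneg_AE del: ennreal_plus)
    then have "(\<integral>A. \<phi> A \<partial>?\<Gamma>) + measure ?\<Gamma> N = Grassmann_angle k C"
      using Grassmann_angle_bounds[OF k(1)] \<phi>_bounds
      by (subst (asm) ennreal_inj) (auto intro!: add_nonneg_nonneg integral_nonneg_AE)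
    then show ?thesis
      using N_prob by (simp add: \<phi>_def N_def)
  qed
qed

section \<open>Expected angle sums of Gaussian projections\<close>

text \<open>
  The dimension of the image is the number of nonzero Gram-Schmidt vectors of the images of a
  basis of \<open>L\<close>.
\<close>

lemma sets_dim_image_eq:
  assumes "subspace L"
  shows "{A :: real ^ 'n ^ 'd. dim ((*v) A ` L) = j} \<in> sets borel"
proof -
  obtain u :: "nat \<Rightarrow> real ^ 'n" where u: "span (u ` {..<dim L}) = L"
    using orthonormal_sequence_subspace[OF assms] by metis
  have "real (dim ((*v) A ` L))
      = (\<Sum>i<dim L. if gram_schmidt (\<lambda>i. A *v u i) i \<noteq> 0 then 1 else 0)" for A :: "real ^ 'n ^ 'd"
  proof -
    have lin: "linear ((*v) A)" by simp
    have "(*v) A ` L = span ((\<lambda>i. A *v u i) ` {..<dim L})"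
      using linear_span_image[OF lin, of "u ` {..<dim L}"] by (simp add: u image_image)
    then have "dim ((*v) A ` L) = card {i\<in>{..<dim L}. gram_schmidt (\<lambda>i. A *v u i) i \<noteq> 0}"
      by (metis dim_span dim_span_gram_schmidt)
    also have "real \<dots> = (\<Sum>i\<in>{i\<in>{..<dim L}. gram_schmidt (\<lambda>i. A *v u i) i \<noteq> 0}. 1)"
      by simp
    also have "\<dots> = (\<Sum>i<dim L. if gram_schmidt (\<lambda>i. A *v u i) i \<noteq> 0 then 1 else 0)"
      by (rule sum.inter_filter) simp
    finally show ?thesis .
  qed
  then have "{A :: real ^ 'n ^ 'd. dim ((*v) A ` L) = j} = {A :: real ^ 'n ^ 'd.
      (\<Sum>i<dim L. if gram_schmidt (\<lambda>i. A *v u i) i \<noteq> 0 then 1 else 0) = real j}"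
    by (metis of_nat_eq_iff)
  also have "\<dots> \<in> sets borel" by measurable
  finally show ?thesis .
qed

lemma dim_image_injective_on:
  fixes A :: "real ^ 'n ^ 'd"
  assumes L: "subspace L" and inj: "\<forall>x\<in>L. A *v x = 0 \<longrightarrow> x = 0"
  shows "dim ((*v) A ` L) = dim L"
proof (rule dim_image_eq)
  show lin: "linear ((*v) A)" by simp
  have "inj_on ((*v) A) L"
  proof (rule inj_onI)
    fix x y assume xy: "x \<in> L" "y \<in> L" "A *v x = A *v y"
    then have "A *v (x - y) = 0" by (simp add: matrix_vector_mult_diff_distrib)
    then show "x = y" using inj subspace_diff[OF L xy(1,2)] by fastforce
  qed
  then show "inj_on ((*v) A) (span L)"
    using L by (metis span_eq_iff)
qed

lemma AE_gaussian_dim_image_ge: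
  fixes L :: "(real ^ 'n) set"
  assumes L: "subspace L" "CARD('d::finite) \<le> dim L"
  shows "AE A in (standard_gaussian :: (real ^ 'n ^ 'd) measure). CARD('d) \<le> dim ((*v) A ` L)"
proof -
  obtain L' where L': "subspace L'" "L' \<subseteq> span L" "dim L' = CARD('d)"
    using choose_subspace_of_subspace[OF L(2)] by metis
  have "AE A in (standard_gaussian :: (real ^ 'n ^ 'd) measure). \<forall>x\<in>L'. A *v x = 0 \<longrightarrow> x = 0"
    using L' by (intro AE_gaussian_matrix_injective_on) auto
  then show ?thesis
  proof eventually_elim
    case (elim A)
    have "L' \<subseteq> L" using L' L(1) by (metis span_eq_iff)
    then have "dim ((*v) A ` L') \<le> dim ((*v) A ` L)"
      by (intro dim_subset image_mono)
    then show ?case using dim_image_injective_on[OF L'(1) elim] L'(3) by simp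
  qed
qed

theorem theorem4p17:
  fixes M :: "'w measure"
    and A :: "'w \<Rightarrow> real ^ 'n::finite ^ 'd::finite"
    and P :: "(real ^ 'n) set"
    and j :: nat and k :: int
  assumes "prob_space M"
    and "gaussian_matrix M A"
    and "CARD('d) \<le> CARD('n)"
    and "polyhedron P" and "interior P \<noteq> {}"
    and "j < CARD('d)"
    and "int j - 1 \<le> k" and "k \<le> int CARD('d) - 1"
  shows "integrable M
           (\<lambda>\<omega>. \<Sum>F\<in>faces_of_dim j ((*v) (A \<omega>) ` P).
                 Grassmann_angle k (tangent_cone F ((*v) (A \<omega>) ` P)))
    \<and> prob_space.expectation M
           (\<lambda>\<omega>. \<Sum>F\<in>faces_of_dim j ((*v) (A \<omega>) ` P).
                 Grassmann_angle k (tangent_cone F ((*v) (A \<omega>) ` P)))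
         = (\<Sum>G\<in>faces_of_dim j P.
              Grassmann_angle k (tangent_cone G P)
              - Grassmann_angle (int CARD('d)) (tangent_cone G P))"
proof -
  interpret M: prob_space M by fact
  let ?\<Gamma> = "standard_gaussian :: (real ^ 'n ^ 'd) measure"
  interpret \<Gamma>: prob_space ?\<Gamma> by (rule prob_space_standard_gaussian)
  have A_meas [measurable]: "A \<in> borel_measurable M" and A_distr: "distr M borel A = ?\<Gamma>"
    using M.gaussian_matrix_distr[OF assms(2)] by auto
  have P: "convex P" "closed P"
    using assms(4) by (simp_all add: polyhedron_imp_convex polyhedron_imp_closed)
  have k: "-1 \<le> k" "k \<le> int CARD('d)" using assms(7,8) by linarith+
  define \<G> where "\<G> = {G. G face_of P \<and> G \<noteq> {}}"
  have fin: "finite \<G>"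
    using finite_polyhedron_faces[OF assms(4)] by (rule finite_subset[rotated]) (auto simp: \<G>_def)
  have face: "G \<subseteq> P" "convex G" "G \<noteq> {}" if "G \<in> \<G>" for G
    using that by (auto simp: \<G>_def face_of_imp_subset face_of_imp_convex)
  have cone: "0 \<in> tangent_cone G P" "fsigma_in euclidean (tangent_cone G P)" if "G \<in> \<G>" for G
    using zero_in_tangent_cone[OF P(1) face[OF that]] fsigma_in_tangent_cone[OF P face[OF that]] by auto
  \<comment> \<open>The contribution of the face \<open>G\<close> of \<open>P\<close> to the sum over the faces of the image under \<open>B\<close>.\<close>
  define X where "X G B = (if persistent_face ((*v) B) P G \<and> dim ((*v) B ` direction_space G) = j
      then Grassmann_angle k ((*v) B ` tangent_cone G P) else 0)" for G and B :: "real ^ 'n ^ 'd"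
  have sum_eq: "(\<Sum>F\<in>faces_of_dim j ((*v) B ` P). Grassmann_angle k (tangent_cone F ((*v) B ` P)))
      = (\<Sum>G\<in>\<G>. X G B)" for B :: "real ^ 'n ^ 'd"
  proof -
    let ?\<H> = "{G \<in> \<G>. persistent_face ((*v) B) P G \<and> dim ((*v) B ` direction_space G) = j}"
    have lin: "linear ((*v) B)" by simp
    have "bij_betw ((`) ((*v) B)) ?\<H> (faces_of_dim j ((*v) B ` P))"
      using faces_linear_image_bij[OF lin P(1), of j] by (simp add: \<G>_def conj_assoc)
    then have "(\<Sum>F\<in>faces_of_dim j ((*v) B ` P). Grassmann_angle k (tangent_cone F ((*v) B ` P)))
        = (\<Sum>G\<in>?\<H>. Grassmann_angle k (tangent_cone ((*v) B ` G) ((*v) B ` P)))"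
      by (rule sum.reindex_bij_betw[symmetric])
    also have "\<dots> = (\<Sum>G\<in>?\<H>. Grassmann_angle k ((*v) B ` tangent_cone G P))"
      using tangent_cone_linear_image[OF lin P(1)] face by (intro sum.cong refl) auto
    also have "\<dots> = (\<Sum>G\<in>\<G>. X G B)"
      unfolding X_def by (rule sum.inter_filter[OF fin])
    finally show ?thesis .
  qed
  have angle_meas: "(\<lambda>B :: real ^ 'n ^ 'd. Grassmann_angle k ((*v) B ` tangent_cone G P))
      \<in> borel_measurable borel" if G: "G \<in> \<G>" for G
  proof (cases "k = -1")
    case True
    then show ?thesis by (simp add: Grassmann_angle_def)
  next
    case False
    then have "k = int (nat k)" using k by simp
    then show ?thesis
      using borel_measurable_Grassmann_angle_image[OF cone[OF G], of "nat k"] by simp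
  qed
  \<comment> \<open>Integrability requires measurability everywhere, so singular matrices cannot be ignored here.\<close>
  have X_meas: "X G \<in> borel_measurable borel" if G: "G \<in> \<G>" for G
  proof -
    let ?K = "tangent_cone G P - direction_space G"
    have "{B :: real ^ 'n ^ 'd. \<exists>v\<in>?K. B *v v = 0} \<in> sets borel"
      using cone[OF G] by (intro sets_kernel_hit fsigma_in_closed_diff closed_subspace) auto
    then have "UNIV - {B :: real ^ 'n ^ 'd. \<exists>v\<in>?K. B *v v = 0} \<in> sets borel" by auto
    also have "UNIV - {B :: real ^ 'n ^ 'd. \<exists>v\<in>?K. B *v v = 0} = {B. persistent_face ((*v) B) P G}"
      by (auto simp: persistent_face_def)
    finally have [measurable]: "Measurable.pred borel (\<lambda>B :: real ^ 'n ^ 'd. persistent_face ((*v) B) P G)"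
      by (simp add: pred_def)
    have [measurable]: "Measurable.pred borel (\<lambda>B :: real ^ 'n ^ 'd. dim ((*v) B ` direction_space G) = j)"
      using sets_dim_image_eq[of "direction_space G" j] by (simp add: pred_def)
    note [measurable] = angle_meas[OF G]
    show ?thesis unfolding X_def by measurable
  qed
  have X_int: "integrable ?\<Gamma> (X G)" if G: "G \<in> \<G>" for G
  proof (rule \<Gamma>.integrable_const_bound)
    show "AE B in ?\<Gamma>. norm (X G B) \<le> 1"
      by (intro AE_I2) (simp add: X_def Grassmann_angle_bounds[OF k(1)])
  qed (use X_meas[OF G] in simp)
  \<comment> \<open>Almost surely the direction space of \<open>G\<close> is mapped injectively or onto the whole space. In the
    second case the image has dimension \<open>d > j\<close>, so only the faces of dimension \<open>j\<close> contribute.\<close>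
  have X_expect: "(\<integral>B. X G B \<partial>?\<Gamma>) = (if dim (direction_space G) = j
      then Grassmann_angle k (tangent_cone G P) - Grassmann_angle (int CARD('d)) (tangent_cone G P)
      else 0)" if G: "G \<in> \<G>" for G
  proof (cases "dim (direction_space G) = j")
    case True
    let ?Y = "\<lambda>B. if \<exists>x\<in>tangent_cone G P - {0}. B *v x = 0 then 0
        else Grassmann_angle k ((*v) B ` tangent_cone G P)"
    have "AE B in ?\<Gamma>. \<forall>x\<in>direction_space G. B *v x = 0 \<longrightarrow> x = 0"
      using True assms(6) by (intro AE_gaussian_matrix_injective_on) auto
    then have "AE B in ?\<Gamma>. X G B = ?Y B"
    proof eventually_elim
      case (elim B)
      have "dim ((*v) B ` direction_space G) = j"
        using dim_image_injective_on[OF subspace_direction_space elim] True by simp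
      moreover have "persistent_face ((*v) B) P G \<longleftrightarrow> \<not> (\<exists>x\<in>tangent_cone G P - {0}. B *v x = 0)"
        using elim subspace_0[of "direction_space G"] by (auto simp: persistent_face_def)
      ultimately show ?case by (simp add: X_def)
    qed
    moreover have "?Y \<in> borel_measurable ?\<Gamma>"
    proof -
      have [measurable]: "Measurable.pred borel (\<lambda>B :: real ^ 'n ^ 'd. \<exists>x\<in>tangent_cone G P - {0}. B *v x = 0)"
        using sets_kernel_hit[OF fsigma_in_closed_diff[OF cone(2)[OF G], of "{0}"]] by (simp add: pred_def)
      note [measurable] = angle_meas[OF G]
      show ?thesis by measurable
    qed
    ultimately have "(\<integral>B. X G B \<partial>?\<Gamma>) = (\<integral>B. ?Y B \<partial>?\<Gamma>)"
      using X_meas[OF G] by (intro integral_cong_AE) auto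
    also have "\<dots> = Grassmann_angle k (tangent_cone G P) - Grassmann_angle (int CARD('d)) (tangent_cone G P)"
      by (rule integral_Grassmann_angle_image[OF cone[OF G] k assms(3)])
    finally show ?thesis using True by simp
  next
    case dim: False
    let ?L = "direction_space G"
    have "AE B in ?\<Gamma>. X G B = 0"
    proof (cases "dim ?L \<le> CARD('d)")
      case True
      have "AE B in ?\<Gamma>. \<forall>x\<in>?L. B *v x = 0 \<longrightarrow> x = 0"
        using True by (intro AE_gaussian_matrix_injective_on) auto
      then show ?thesis
        by eventually_elim (use dim in \<open>simp add: X_def dim_image_injective_on\<close>)
    next
      case False
      have "AE B in ?\<Gamma>. CARD('d) \<le> dim ((*v) B ` ?L)"
        using False by (intro AE_gaussian_dim_image_ge) auto
      then show ?thesis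
        by eventually_elim (use assms(6) in \<open>auto simp: X_def\<close>)
    qed
    then have "(\<integral>B. X G B \<partial>?\<Gamma>) = 0"
      by (rule integral_eq_zero_AE)
    then show ?thesis using dim by simp
  qed
  have faces_eq: "faces_of_dim j P = {G \<in> \<G>. dim (direction_space G) = j}"
  proof -
    have "aff_dim G = int j \<longleftrightarrow> G \<noteq> {} \<and> dim (direction_space G) = j" for G :: "(real ^ 'n) set"
      by (cases "G = {}") (auto simp: aff_dim_direction_space)
    then show ?thesis by (auto simp: faces_of_dim_def \<G>_def)
  qed
  have int: "integrable ?\<Gamma> (\<lambda>B. \<Sum>G\<in>\<G>. X G B)"
    using X_int by (rule Bochner_Integration.integrable_sum)
  have meas: "(\<lambda>B. \<Sum>G\<in>\<G>. X G B) \<in> borel_measurable borel"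
    using X_meas by (rule borel_measurable_sum)
  have "integrable M (\<lambda>\<omega>. \<Sum>G\<in>\<G>. X G (A \<omega>))"
    using int unfolding A_distr[symmetric] by (subst (asm) integrable_distr_eq) (auto intro: meas)
  moreover have "(\<integral>\<omega>. (\<Sum>G\<in>\<G>. X G (A \<omega>)) \<partial>M) = (\<Sum>G\<in>faces_of_dim j P.
      Grassmann_angle k (tangent_cone G P) - Grassmann_angle (int CARD('d)) (tangent_cone G P))"
  proof -
    have "(\<integral>\<omega>. (\<Sum>G\<in>\<G>. X G (A \<omega>)) \<partial>M) = (\<integral>B. (\<Sum>G\<in>\<G>. X G B) \<partial>?\<Gamma>)"
      unfolding A_distr[symmetric] by (rule integral_distr[symmetric]) (auto intro: meas)
    also have "\<dots> = (\<Sum>G\<in>\<G>. \<integral>B. X G B \<partial>?\<Gamma>)"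
      using X_int by (rule Bochner_Integration.integral_sum)
    also have "\<dots> = (\<Sum>G\<in>faces_of_dim j P.
        Grassmann_angle k (tangent_cone G P) - Grassmann_angle (int CARD('d)) (tangent_cone G P))"
      unfolding faces_eq sum.inter_filter[OF fin] by (intro sum.cong refl X_expect)
    finally show ?thesis .
  qed
  ultimately show ?thesis unfolding sum_eq by blast
qed

end
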